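(* For every composition $\beta$, \[R_\beta=\sum_{\alpha\ge_{\mathrm{lex}}\beta}L_{\alpha,\beta}\,{\mathfrak S}_\alpha,\] the sum over compositions $\alpha$ of $|\beta|$ lexicographically at least $\beta$, where $L_{\alpha,\beta}$ is the number of standard immaculate tableaux of shape $\alpha$ and descent composition $\beta$. In particular $R_\beta$ expands positively in the immaculate basis.
   Context: Work over $\mathbb{Q}$. A composition $\alpha=[\alpha_1,\dots,\alpha_m]$ of $n$ is a sequence of positive integers with sum $|\alpha|=n$, length $\ell(\alpha)=m$; identify it with $D(\alpha)=\{\alpha_1,\alpha_1+\alpha_2,\dots,\alpha_1+\dots+\alpha_{m-1}\}\subseteq\{1,\dots,n-1\}$ (a bijection), and set $\alpha\le\beta$ iff $D(\beta)\subseteq D(\alpha)$. $\mathsf{NSym}$ is the free associative $\mathbb{Q}$-algebra on $H_1,H_2,\dots$ ($\deg H_i=i$); $H_{(a_1,\dots,a_m)}=H_{a_1}\cdots H_{a_m}$, $H_0=1$, $H_{-r}=0$ for $r>0$. The ribbon functions are $R_\alpha=\sum_{\beta\ge\alpha}(-1)^{\ell(\alpha)-\ell(\beta)}H_\beta$. $\mathsf{QSym}$ has monomial basis $M_\alpha=\sum_{i_1<\dots<i_m}x_{i_1}^{\alpha_1}\cdots x_{i_m}^{\alpha_m}$, paired with $\mathsf{NSym}$ by $\langle H_\alpha,M_\beta\rangle=\delta_{\alpha,\beta}$; $F^\perp$ is defined by $\langle F^\perp H,G\rangle=\langle H,FG\rangle$. $F_\alpha=\sum_{\beta\le\alpha}M_\beta$,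 $F_{1^i}=F_{(1,\dots,1)}$ ($i$ ones, $F_{1^0}=1$). $\mathbb{B}_m=\sum_{i\ge0}(-1)^iH_{m+i}F_{1^i}^\perp$, and for $\alpha\in\mathbb{Z}^m$, ${\mathfrak S}_\alpha=\mathbb{B}_{\alpha_1}\cdots\mathbb{B}_{\alpha_m}(1)$. A standard immaculate tableau of shape $\alpha$ is a filling of the diagram of $\alpha$ (row $j$ has $\alpha_j$ left-justified boxes, rows numbered from the top) with $1,2,\dots,|\alpha|$, each used once, increasing left to right along each row and increasing from top to bottom along the first column (no condition on other columns). Such a tableau $T$ has a descent at $i$ if $i+1$ lies in a row strictly lower (larger row index) than $i$; its descent composition is the composition of $|\alpha|$ whose associated set $D$ is the set of descents of $T$. *)

theory Defs
  imports Complex_Main "HOL-Library.FuncSet" "HOL-Library.Poly_Mapping"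
begin

typedef composition = "{xs :: nat list. 0 \<notin> set xs}"
  morphisms parts Comp
  by (rule exI[of _ "[]"]) simp

definition weight :: "composition \<Rightarrow> nat" where
  "weight \<alpha> = sum_list (parts \<alpha>)"

definition len :: "composition \<Rightarrow> nat" where
  "len \<alpha> = length (parts \<alpha>)"

definition D :: "composition \<Rightarrow> nat set" where
  "D \<alpha> = {sum_list (take k (parts \<alpha>)) |k. 1 \<le> k \<and> k < len \<alpha>}"

text \<open>\<open>finer \<alpha> \<beta>\<close> is the relation \<open>\<alpha> \<le> \<beta>\<close>; \<open>D\<close> determines a composition only once the weight is fixed.\<close>

definition finer :: "composition \<Rightarrow> composition \<Rightarrow> bool" where
  "finer \<alpha> \<beta> \<longleftrightarrow> weight \<alpha> = weight \<beta> \<and> D \<beta> \<subseteq> D \<alpha>"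

definition lex_le :: "composition \<Rightarrow> composition \<Rightarrow> bool" where
  "lex_le \<alpha> \<beta> \<longleftrightarrow> ord_class.lexordp_eq (parts \<alpha>) (parts \<beta>)"

text \<open>Concatenation makes the compositions the free monoid on the positive integers.
  It is written additively because that is how \<^theory>\<open>HOL-Library.Poly_Mapping\<close> expects
  the exponents of a monoid algebra.\<close>

instantiation composition :: monoid_add
begin

definition zero_composition :: composition where
  "0 = Comp []"

definition plus_composition :: "composition \<Rightarrow> composition \<Rightarrow> composition" where
  "\<alpha> + \<beta> = Comp (parts \<alpha> @ parts \<beta>)"

instance
proof
  have app: "parts (Comp (parts x @ parts y)) = parts x @ parts y" for x y
    using parts[of x] parts[of y] by (simp add: Comp_inverse)
  have nil: "parts (Comp []) = []"
    by (simp add: Comp_inverse)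
  fix a b c :: composition
  show "a + b + c = a + (b + c)"
    by (simp add: plus_composition_def app)
  show "0 + a = a" "a + 0 = a"
    by (simp_all add: plus_composition_def zero_composition_def nil parts_inverse)
qed

end

text \<open>The free associative algebra on \<open>H\<^sub>1, H\<^sub>2, \<dots>\<close> is the monoid algebra of the free monoid
  above: the word \<open>H\<^sub>a\<^sub>1 \<cdots> H\<^sub>a\<^sub>m\<close> is the basis vector at the composition \<open>(a\<^sub>1, \<dots>, a\<^sub>m)\<close>, and
  the ring structure is that of \<^theory>\<open>HOL-Library.Poly_Mapping\<close>.\<close>

type_synonym nsym = "composition \<Rightarrow>\<^sub>0 rat"

definition nsym_scale :: "rat \<Rightarrow> nsym \<Rightarrow> nsym" where
  "nsym_scale c h = Poly_Mapping.map ((*) c) h"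

interpretation nsym: vector_space nsym_scale
proof
  have [simp]: "Poly_Mapping.lookup (nsym_scale c h) \<alpha> = c * Poly_Mapping.lookup h \<alpha>" for c h \<alpha>
    by (simp add: nsym_scale_def Poly_Mapping.map.rep_eq when_def)
  fix a b :: rat and x y :: nsym
  show "nsym_scale a (x + y) = nsym_scale a x + nsym_scale a y"
    "nsym_scale (a + b) x = nsym_scale a x + nsym_scale b x"
    "nsym_scale a (nsym_scale b x) = nsym_scale (a * b) x"
    "nsym_scale 1 x = x"
    by (rule poly_mapping_eqI; simp add: lookup_add algebra_simps)+
qed

definition H :: "int \<Rightarrow> nsym" where
  "H r = (if r < 0 then 0 else if r = 0 then 1 else Poly_Mapping.single (Comp [nat r]) 1)"

definition H_comp :: "composition \<Rightarrow> nsym" where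
  "H_comp \<alpha> = prod_list (map (\<lambda>a. H (int a)) (parts \<alpha>))"

definition ribbon :: "composition \<Rightarrow> nsym" where
  "ribbon \<alpha> = (\<Sum>\<beta> | finer \<alpha> \<beta>. (- 1) ^ (len \<alpha> - len \<beta>) * H_comp \<beta>)"

text \<open>Formal power series in \<open>x\<^sub>0, x\<^sub>1, \<dots>\<close>, given by their coefficients at monomials.\<close>

type_synonym power_series = "(nat \<Rightarrow>\<^sub>0 nat) \<Rightarrow> rat"

definition ps_mult :: "power_series \<Rightarrow> power_series \<Rightarrow> power_series" where
  "ps_mult f g = (\<lambda>m. \<Sum>(p, q) | p + q = m. f p * g q)"

text \<open>The coefficient of a monomial in \<open>M\<^sub>\<alpha>\<close> is the number of index sequences
  \<open>i\<^sub>1 < \<dots> < i\<^sub>m\<close> whose summand is that monomial.\<close>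

definition M :: "composition \<Rightarrow> power_series" where
  "M \<alpha> = (\<lambda>m. of_nat (card {is. length is = len \<alpha> \<and> sorted_wrt (<) is \<and>
      m = (\<Sum>k<len \<alpha>. Poly_Mapping.single (is ! k) (parts \<alpha> ! k))}))"

definition M_expansion :: "(composition \<Rightarrow>\<^sub>0 rat) \<Rightarrow> power_series" where
  "M_expansion c = (\<lambda>m. \<Sum>\<alpha>\<in>Poly_Mapping.keys c. Poly_Mapping.lookup c \<alpha> * M \<alpha> m)"

definition QSym :: "power_series set" where
  "QSym = range M_expansion"

definition M_coords :: "power_series \<Rightarrow> (composition \<Rightarrow>\<^sub>0 rat)" where
  "M_coords g = (THE c. g = M_expansion c)"

text \<open>\<^term>\<open>Poly_Mapping.lookup h \<alpha>\<close> is the coefficient of \<open>H\<^sub>\<alpha>\<close> in \<open>h\<close>, so this is the bilinear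
  extension of \<open>\<langle>H\<^sub>\<alpha>, M\<^sub>\<beta>\<rangle> = \<delta>\<^sub>\<alpha>\<^sub>\<beta>\<close>. It is meaningful only for \<open>g\<close> in \<^const>\<open>QSym\<close>.\<close>

definition pairing :: "nsym \<Rightarrow> power_series \<Rightarrow> rat" where
  "pairing h g = (\<Sum>\<alpha>\<in>Poly_Mapping.keys h.
     Poly_Mapping.lookup h \<alpha> * Poly_Mapping.lookup (M_coords g) \<alpha>)"

definition perp :: "power_series \<Rightarrow> nsym \<Rightarrow> nsym" where
  "perp f h = (THE k. \<forall>g\<in>QSym. pairing k g = pairing h (ps_mult f g))"

definition F :: "composition \<Rightarrow> power_series" where
  "F \<alpha> = (\<lambda>m. \<Sum>\<beta> | finer \<beta> \<alpha>. M \<beta> m)"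

text \<open>Applied to a fixed \<open>h\<close>, only finitely many terms of the operator series are nonzero;
  \<^const>\<open>Sum_any\<close> sums over these.\<close>

definition B :: "int \<Rightarrow> nsym \<Rightarrow> nsym" where
  "B m h = Sum_any (\<lambda>i::nat. (- 1) ^ i * H (m + int i) * perp (F (Comp (replicate i 1))) h)"

definition immaculate :: "int list \<Rightarrow> nsym" where
  "immaculate \<alpha> = foldr B \<alpha> 1"

abbreviation immaculate_comp :: "composition \<Rightarrow> nsym" where
  "immaculate_comp \<alpha> \<equiv> immaculate (map int (parts \<alpha>))"

text \<open>The box \<open>(j, c)\<close> lies in row \<open>j\<close> and column \<open>c\<close>, both counted from 0.\<close>

definition diagram :: "composition \<Rightarrow> (nat \<times> nat) set" where
  "diagram \<alpha> = {(j, c). j < len \<alpha> \<and> c < parts \<alpha> ! j}"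

definition standard_immaculate_tableaux :: "composition \<Rightarrow> (nat \<times> nat \<Rightarrow> nat) set" where
  "standard_immaculate_tableaux \<alpha> = {T \<in> extensional (diagram \<alpha>).
     bij_betw T (diagram \<alpha>) {1..weight \<alpha>} \<and>
     (\<forall>j c c'. (j, c) \<in> diagram \<alpha> \<longrightarrow> (j, c') \<in> diagram \<alpha> \<longrightarrow> c < c' \<longrightarrow> T (j, c) < T (j, c')) \<and>
     (\<forall>j j'. (j, 0) \<in> diagram \<alpha> \<longrightarrow> (j', 0) \<in> diagram \<alpha> \<longrightarrow> j < j' \<longrightarrow> T (j, 0) < T (j', 0))}"

definition descents :: "composition \<Rightarrow> (nat \<times> nat \<Rightarrow> nat) \<Rightarrow> nat set" where
  "descents \<alpha> T = {i. \<exists>j c j' c'. (j, c) \<in> diagram \<alpha> \<and> (j', c') \<in> diagram \<alpha> \<and>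
     T (j, c) = i \<and> T (j', c') = i + 1 \<and> j < j'}"

definition descent_composition :: "composition \<Rightarrow> (nat \<times> nat \<Rightarrow> nat) \<Rightarrow> composition" where
  "descent_composition \<alpha> T = (THE \<gamma>. weight \<gamma> = weight \<alpha> \<and> D \<gamma> = descents \<alpha> T)"

definition L :: "composition \<Rightarrow> composition \<Rightarrow> nat" where
  "L \<alpha> \<beta> = card {T \<in> standard_immaculate_tableaux \<alpha>. descent_composition \<alpha> T = \<beta>}"

end

theory Submission
  imports Defs "HOL-Library.Multiset"
begin

text \<open>The series \<open>M\<^sub>\<alpha>\<close> takes the value 1 at the monomials whose nonzero exponents, read by
  increasing index, form \<open>\<alpha>\<close>, and 0 elsewhere. This makes \<^const>\<open>perp\<close> of \<open>F\<close> at a composition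
  of ones explicit: it sums over the ways of lowering by one the indices of that many factors of a
  word. Hence \<open>B m h * H s = B m (h * H s) + B (m + 1) h * H (s - 1)\<close>, and iterating this gives
  the Pieri rule for right multiplication of an immaculate function by \<open>H s\<close>.

  Recording the row of each entry turns a standard immaculate tableau into a word in which every
  letter is preceded by all smaller letters; descents become ascents. The Pieri rule appends a weakly
  decreasing run to such words, so \<open>H\<^sub>\<alpha>\<close> is the sum of the immaculate functions of the contents
  of the words with ascents in \<open>D \<alpha>\<close>, and Moebius inversion selects those with ascent
  set exactly \<open>D \<beta>\<close>.

  The leading term of an immaculate function at \<open>\<alpha>\<close> is \<open>H\<^sub>\<alpha>\<close>, all others being
  lexicographically larger. This yields linear independence. Since a ribbon only involves coarser,
  hence lexicographically larger, words, it also forces \<open>L \<alpha> \<beta> = 0\<close> unless \<open>\<alpha>\<close> is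
  lexicographically at least \<open>\<beta>\<close>.\<close>

subsection \<open>Compositions\<close>

abbreviation "lookup \<equiv> Poly_Mapping.lookup"
abbreviation "keys \<equiv> Poly_Mapping.keys"
abbreviation "single \<equiv> Poly_Mapping.single"

lemma parts_Comp: "0 \<notin> set xs \<Longrightarrow> parts (Comp xs) = xs"
  by (simp add: Comp_inverse)

lemma parts_plus [simp]: "parts (\<alpha> + \<beta>) = parts \<alpha> @ parts \<beta>"
  using parts[of \<alpha>] parts[of \<beta>] by (simp add: plus_composition_def parts_Comp)

lemma parts_0 [simp]: "parts 0 = []"
  by (simp add: zero_composition_def parts_Comp)

lemma zero_notin_parts [simp]: "0 \<notin> set (parts \<alpha>)"
  using parts[of \<alpha>] by simp

lemma composition_eqI: "parts \<alpha> = parts \<beta> \<Longrightarrow> \<alpha> = \<beta>"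
  by (simp add: parts_inject)

lemma parts_eq_Nil [simp]: "parts \<alpha> = [] \<longleftrightarrow> \<alpha> = 0"
  using parts_inject[of \<alpha> 0] by simp

text \<open>\<open>part 0\<close> is the empty composition, in accordance with
  \<open>H 0 = 1\<close>: a factor whose index drops to 0 disappears from the word.\<close>

definition part :: "nat \<Rightarrow> composition" where
  "part a = Comp (if a = 0 then [] else [a])"

lemma parts_part [simp]: "parts (part a) = (if a = 0 then [] else [a])"
  by (simp add: part_def parts_Comp)

lemma composition_cases_snoc:
  obtains "\<gamma> = 0" | \<alpha> a where "\<gamma> = \<alpha> + part a" "a > 0"
proof (cases "parts \<gamma>" rule: rev_cases)
  case Nil
  then show ?thesis using that(1) by simp
next
  case (snoc xs a)
  then have "0 \<notin> set xs" "a > 0" using zero_notin_parts[of \<gamma>] by auto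
  then show ?thesis using that(2)[of "Comp xs" a] snoc
    by (metis append_Cons append_Nil composition_eqI neq0_conv parts_Comp parts_part parts_plus)
qed

lemma composition_cases_Cons:
  obtains "\<gamma> = 0" | \<alpha> a where "\<gamma> = part a + \<alpha>" "a > 0"
proof (cases "parts \<gamma>")
  case Nil
  then show ?thesis using that(1) by simp
next
  case (Cons a xs)
  then have "0 \<notin> set xs" "a > 0" using zero_notin_parts[of \<gamma>] by auto
  then show ?thesis using that(2)[of a "Comp xs"] Cons
    by (metis append_Cons append_Nil composition_eqI neq0_conv parts_Comp parts_part parts_plus)
qed

lemma composition_rev_induct [case_names zero snoc]:
  assumes "P 0" and "\<And>\<alpha> a. P \<alpha> \<Longrightarrow> a > 0 \<Longrightarrow> P (\<alpha> + part a)"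
  shows "P \<gamma>"
proof (induction "length (parts \<gamma>)" arbitrary: \<gamma>)
  case 0
  then show ?case using assms(1) by simp
next
  case (Suc n)
  show ?case
    using assms(2) Suc(1) Suc(2) by (cases \<gamma> rule: composition_cases_snoc) auto
qed

lemma composition_induct [case_names zero Cons]:
  assumes "P 0" and "\<And>\<alpha> a. P \<alpha> \<Longrightarrow> a > 0 \<Longrightarrow> P (part a + \<alpha>)"
  shows "P \<gamma>"
proof (induction "length (parts \<gamma>)" arbitrary: \<gamma>)
  case 0
  then show ?case using assms(1) by simp
next
  case (Suc n)
  show ?case
    using assms(2) Suc(1) Suc(2) by (cases \<gamma> rule: composition_cases_Cons) auto
qed

lemma weight_simps [simp]: "weight 0 = 0" "weight (\<alpha> + \<beta>) = weight \<alpha> + weight \<beta>" "weight (part a) = a"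
  by (auto simp: weight_def)

lemma len_simps [simp]: "len 0 = 0" "len (\<alpha> + \<beta>) = len \<alpha> + len \<beta>" "len (part a) = (if a = 0 then 0 else 1)"
  by (auto simp: len_def)

lemma D_0 [simp]: "D 0 = {}"
  by (auto simp: D_def)

text \<open>\<open>D\<close> omits the total, so a new last part turns the old total
  \<open>weight \<alpha>\<close> into a proper partial sum. For the empty composition this total is
  0, which \<open>D\<close> never contains.\<close>

lemma D_snoc:
  assumes "a > 0"
  shows "D (\<alpha> + part a) = (if \<alpha> = 0 then {} else insert (weight \<alpha>) (D \<alpha>))"
proof -
  let ?xs = "parts \<alpha>"
  have "D (\<alpha> + part a) = {sum_list (take k (?xs @ [a])) |k. 1 \<le> k \<and> k \<le> length ?xs}"
    using assms by (auto simp: D_def len_def less_Suc_eq_le)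
  also have "\<dots> = (\<lambda>k. sum_list (take k ?xs)) ` {1..length ?xs}"
    unfolding image_def by (rule Collect_cong) (metis (no_types, lifting) append_Nil2 atLeastAtMost_iff
      diff_is_0_eq' take0 take_append)
  also have "{1..length ?xs} = (if \<alpha> = 0 then {} else insert (length ?xs) {1..<length ?xs})"
    by (cases "parts \<alpha>") (auto simp flip: parts_eq_Nil)
  finally show ?thesis
    by (auto simp: D_def len_def weight_def image_iff)
qed

lemma weight_eq_0 [simp]: "weight \<alpha> = 0 \<longleftrightarrow> \<alpha> = 0"
proof
  assume "weight \<alpha> = 0"
  then have "x = 0" if "x \<in> set (parts \<alpha>)" for x using that by (auto simp: weight_def)
  then show "\<alpha> = 0" using zero_notin_parts[of \<alpha>] by (metis list.set_intros(1) neq_Nil_conv parts_eq_Nil)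
qed simp

lemma D_subset: "D \<alpha> \<subseteq> {1..<weight \<alpha>}"
proof (induction \<alpha> rule: composition_rev_induct)
  case (snoc \<alpha> a)
  then show ?case
    using weight_eq_0[of \<alpha>] by (auto simp: D_snoc Suc_le_eq simp del: weight_eq_0)
qed simp

lemma finite_D [simp]: "finite (D \<alpha>)"
  by (rule finite_subset[OF D_subset]) simp

lemma card_D: "card (D \<alpha>) = len \<alpha> - 1"
proof (induction \<alpha> rule: composition_rev_induct)
  case (snoc \<alpha> a)
  have "weight \<alpha> \<notin> D \<alpha>" using D_subset[of \<alpha>] by auto
  moreover have "\<alpha> \<noteq> 0 \<Longrightarrow> len \<alpha> > 0" by (auto simp: len_def)
  ultimately show ?case using snoc by (auto simp: D_snoc)
qed simp

lemma D_inject: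
  assumes "weight \<alpha> = weight \<beta>" "D \<alpha> = D \<beta>"
  shows "\<alpha> = \<beta>"
  using assms
proof (induction \<alpha> arbitrary: \<beta> rule: composition_rev_induct)
  case zero
  then show ?case by (metis weight_eq_0 weight_simps(1))
next
  case (snoc \<alpha> a)
  then have "\<beta> \<noteq> 0" by auto
  then obtain \<gamma> b where \<beta>: "\<beta> = \<gamma> + part b" "b > 0"
    by (cases \<beta> rule: composition_cases_snoc) auto
  \<comment> \<open>\<open>D \<delta>\<close> lies strictly below \<open>weight \<delta>\<close>, so
    the maximum of the enlarged set returns the weight and its removal returns
    \<open>D \<delta>\<close>.\<close>
  have Max: "Max (insert (weight \<delta>) (D \<delta>)) = weight \<delta>" "insert (weight \<delta>) (D \<delta>) - {weight \<delta>} = D \<delta>" for \<delta>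
    using D_subset[of \<delta>] by (auto intro!: Max_eqI)
  have eq: "(if \<alpha> = 0 then {} else insert (weight \<alpha>) (D \<alpha>)) = (if \<gamma> = 0 then {} else insert (weight \<gamma>) (D \<gamma>))"
    using snoc(2,4) \<beta> by (simp add: D_snoc)
  have "\<alpha> = \<gamma>"
  proof (cases "\<alpha> = 0")
    case False
    with eq have "insert (weight \<alpha>) (D \<alpha>) = insert (weight \<gamma>) (D \<gamma>)" by (auto split: if_splits)
    then have "weight \<alpha> = weight \<gamma>" "D \<alpha> = D \<gamma>" using Max by metis+
    then show ?thesis using snoc(1) by blast
  qed (use eq in \<open>auto split: if_splits\<close>)
  then show ?case using \<beta> snoc(3) by simp
qed

text \<open>The largest element of \<open>S\<close> is the weight of everything before the last
  part; strong induction on \<open>n\<close> supplies the rest. With \<open>D_inject\<close>,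
  compositions of \<open>n\<close> correspond to subsets of \<open>{1..<n}\<close>.\<close>

lemma ex_composition_D:
  assumes "S \<subseteq> {1..<n}"
  shows "\<exists>\<alpha>. weight \<alpha> = n \<and> D \<alpha> = S"
  using assms
proof (induction n arbitrary: S rule: less_induct)
  case (less n)
  show ?case
  proof (cases "S = {}")
    case True
    show ?thesis
    proof (cases "n = 0")
      case True
      then show ?thesis using \<open>S = {}\<close> by (intro exI[of _ 0]) auto
    next
      case False
      then have "D (0 + part n) = S" using \<open>S = {}\<close> D_snoc[of n 0] by simp
      then show ?thesis by (intro exI[of _ "part n"]) auto
    qed
  next
    case False
    have fin: "finite S" by (rule finite_subset[OF less(2)]) simp
    define k where "k = Max S"
    have k: "k \<in> S" using fin False by (simp add: k_def)
    have sub: "S - {k} \<subseteq> {1..<k}"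
    proof
      fix x assume "x \<in> S - {k}"
      then have "x \<le> k" "x \<noteq> k" "x \<ge> 1" using fin less(2) by (auto simp: k_def)
      then show "x \<in> {1..<k}" by auto
    qed
    have kn: "0 < k" "k < n" using k less(2) by auto
    obtain \<alpha> where \<alpha>: "weight \<alpha> = k" "D \<alpha> = S - {k}"
      using less(1)[OF kn(2) sub] by (elim exE conjE)
    have "\<alpha> \<noteq> 0" using \<alpha>(1) kn(1) by (metis less_numeral_extra(3) weight_simps(1))
    then have "D (\<alpha> + part (n - k)) = S" using \<alpha> k kn by (simp add: D_snoc insert_absorb)
    moreover have "weight (\<alpha> + part (n - k)) = n" using \<alpha> kn by simp
    ultimately show ?thesis by blast
  qed
qed

lemma finite_weight_le: "finite {\<alpha>. weight \<alpha> \<le> n}"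
proof -
  have "parts ` {\<alpha>. weight \<alpha> \<le> n} \<subseteq> {xs. set xs \<subseteq> {..n} \<and> length xs \<le> n}"
  proof clarify
    fix \<alpha> assume *: "weight \<alpha> \<le> n"
    have "length xs \<le> sum_list xs" if "0 \<notin> set xs" for xs :: "nat list"
      using that by (induction xs) auto
    from this[of "parts \<alpha>"] have "length (parts \<alpha>) \<le> n" using * by (simp add: weight_def)
    moreover have "set (parts \<alpha>) \<subseteq> {..n}"
      using * member_le_sum_list[of _ "parts \<alpha>"] by (auto simp: weight_def intro: order_trans)
    ultimately show "set (parts \<alpha>) \<subseteq> {..n} \<and> length (parts \<alpha>) \<le> n" by blast
  qed
  moreover have "finite {xs. set xs \<subseteq> {..n} \<and> length xs \<le> n}"
    by (rule finite_lists_length_le) simp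
  ultimately have "finite (parts ` {\<alpha>. weight \<alpha> \<le> n})" by (rule finite_subset)
  then show ?thesis by (rule finite_imageD) (auto simp: inj_on_def parts_inject)
qed

lemma finite_weight_eq [simp]: "finite {\<alpha>. weight \<alpha> = n}"
  by (rule finite_subset[OF _ finite_weight_le[of n]]) auto

subsection \<open>The free algebra\<close>

lemma H_nat: "H (int a) = single (part a) 1"
  by (cases "a = 0") (auto simp: H_def part_def zero_composition_def[symmetric])

lemma H_comp_eq: "H_comp \<alpha> = single \<alpha> 1"
proof (induction \<alpha> rule: composition_induct)
  case (Cons \<alpha> a)
  then show ?case by (simp add: H_comp_def H_nat mult_single)
qed (simp add: H_comp_def)

lemma lookup_nsym_scale [simp]: "lookup (nsym_scale c h) \<alpha> = c * lookup h \<alpha>"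
  by (simp add: nsym_scale_def Poly_Mapping.map.rep_eq when_def)

lemma nsym_scale_mult_left: "nsym_scale c (x * y) = nsym_scale c x * y"
  by (simp add: nsym_scale_def mult_map_scale_conv_mult mult.assoc)

lemma nsym_scale_single: "nsym_scale c (single \<alpha> r) = single \<alpha> (c * r)"
  by (rule poly_mapping_eqI) (simp add: lookup_single when_def)

lemma nsym_induct [case_names single add]:
  fixes h :: nsym
  assumes "\<And>\<alpha> r. P (single \<alpha> r)" and "\<And>x y. P x \<Longrightarrow> P y \<Longrightarrow> P (x + y)"
  shows "P h"
proof (induction h rule: update_induct)
  case const
  show ?case using assms(1)[of 0 0] by simp
next
  case (update f a b)
  have "Poly_Mapping.update a b f = single a b + f"
    using update(1) by (intro poly_mapping_eqI)
      (auto simp: lookup_update lookup_add lookup_single when_def in_keys_iff)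
  then show ?case using assms update by metis
qed

text \<open>The second argument is any function on compositions, not only a finitely supported one,
  so that shifts of \<open>c\<close> can be formed without support conditions.
  \<open>pairing_M_expansion\<close> links it to \<open>pairing\<close>.\<close>

definition pair :: "nsym \<Rightarrow> (composition \<Rightarrow> rat) \<Rightarrow> rat" where
  "pair h c = (\<Sum>\<alpha>\<in>keys h. lookup h \<alpha> * c \<alpha>)"

lemma pair_0 [simp]: "pair 0 c = 0"
  by (simp add: pair_def)

lemma pair_add: "pair (x + y) c = pair x c + pair y c"
  unfolding pair_def by (rule setsum_keys_plus_distrib) (auto simp: algebra_simps)

lemma pair_sum: "pair (sum f A) c = (\<Sum>a\<in>A. pair (f a) c)"
  by (induction A rule: infinite_finite_induct) (auto simp: pair_add)

lemma pair_single [simp]: "pair (single \<alpha> r) c = r * c \<alpha>"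
  by (cases "r = 0") (auto simp: pair_def)

lemma pair_one [simp]: "pair 1 c = c 0"
  using pair_single[of 0 1] by simp

lemma pair_scale: "pair (nsym_scale r h) c = r * pair h c"
  by (induction h rule: nsym_induct)
    (auto simp: nsym_scale_single nsym.scale_right_distrib pair_add algebra_simps)

lemma pair_mult_H: "pair (h * H (int a)) c = pair h (\<lambda>\<alpha>. c (\<alpha> + part a))"
  by (induction h rule: nsym_induct) (auto simp: H_nat mult_single pair_add distrib_right)

lemma pair_delta: "pair h (\<lambda>\<beta>. if \<beta> = \<alpha> then 1 else 0) = lookup h \<alpha>"
  by (induction h rule: nsym_induct)
    (auto simp: pair_add lookup_add lookup_single when_def)

subsection \<open>Monomial expansions and products\<close>

definition flat :: "(nat \<Rightarrow>\<^sub>0 nat) \<Rightarrow> composition" where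
  "flat m = Comp (map (lookup m) (sorted_list_of_set (keys m)))"

lemma parts_flat: "parts (flat m) = map (lookup m) (sorted_list_of_set (keys m))"
  unfolding flat_def by (rule parts_Comp) (auto simp: in_keys_iff)

lemma flat_0 [simp]: "flat 0 = 0"
  by (rule composition_eqI) (simp add: parts_flat)

text \<open>A variable beyond all others comes last in the sorted list of variables. Extending a
  monomial at its largest index thus matches appending a part.\<close>

lemma flat_add:
  assumes "\<And>x. x \<in> keys m \<Longrightarrow> x < k"
  shows "flat (m + single k a) = flat m + part a"
proof (cases "a = 0")
  case True
  then show ?thesis by (auto intro!: composition_eqI)
next
  case False
  have k: "lookup m k = 0" using assms[of k] by (auto simp: in_keys_iff)
  have keys: "keys (m + single k a) = insert k (keys m)"
    using False k by (auto simp: in_keys_iff lookup_add lookup_single when_def split: if_splits)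
  have sl: "sorted_list_of_set (insert k (keys m)) = sorted_list_of_set (keys m) @ [k]"
  proof (rule sorted_distinct_set_unique)
    show "set (sorted_list_of_set (insert k (keys m))) = set (sorted_list_of_set (keys m) @ [k])"
      by (subst set_sorted_list_of_set) auto
  qed (use assms in \<open>auto simp: sorted_append less_imp_le
    simp del: sorted_list_of_set_insert_remove\<close>)
  show ?thesis
    using False k
    by (intro composition_eqI)
      (auto simp: parts_flat keys sl lookup_add lookup_single when_def in_keys_iff)
qed

lemma lookup_sum_single:
  assumes "distinct is" "length is = n"
  shows "k < n \<Longrightarrow> lookup (\<Sum>j<n. single (is ! j) (f j :: nat)) (is ! k) = f k"
    and "x \<notin> set is \<Longrightarrow> lookup (\<Sum>j<n. single (is ! j) (f j :: nat)) x = 0"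
proof -
  assume k: "k < n"
  have "lookup (\<Sum>j<n. single (is ! j) (f j)) (is ! k) = (\<Sum>j<n. if j = k then f j else 0)"
    using assms k unfolding lookup_sum lookup_single when_def
    by (intro sum.cong) (auto simp: nth_eq_iff_index_eq)
  then show "lookup (\<Sum>j<n. single (is ! j) (f j)) (is ! k) = f k"
    using k by simp
next
  assume "x \<notin> set is"
  then show "lookup (\<Sum>j<n. single (is ! j) (f j)) x = 0"
    using assms unfolding lookup_sum lookup_single when_def by (auto intro!: sum.neutral)
qed

text \<open>The parts of \<open>\<alpha>\<close> are positive, so an admissible index sequence must
  list exactly the variables of \<open>m\<close> in increasing order. There is at most one such
  sequence, and it works iff the exponents in that order form \<open>\<alpha>\<close>.\<close>

lemma M_eq: "M \<alpha> m = (if flat m = \<alpha> then 1 else 0)"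
proof -
  define S where "S = {is. length is = len \<alpha> \<and> sorted_wrt (<) is \<and>
      m = (\<Sum>k<len \<alpha>. single (is ! k) (parts \<alpha> ! k))}"
  have flat: "flat m = \<alpha> \<and> is = sorted_list_of_set (keys m)" if "is \<in> S" for "is"
  proof -
    have l: "length is = len \<alpha>" and srt: "sorted_wrt (<) is"
      and m: "m = (\<Sum>k<len \<alpha>. single (is ! k) (parts \<alpha> ! k))"
      using that by (auto simp: S_def)
    have dist: "distinct is" and "sorted is"
      using srt strict_sorted_iff by auto
    note lk = lookup_sum_single[OF dist l, of _ "\<lambda>k. parts \<alpha> ! k", folded m]
    have pos: "parts \<alpha> ! k \<noteq> 0" if "k < len \<alpha>" for k
      using that zero_notin_parts[of \<alpha>] by (metis len_def nth_mem)
    have keys: "keys m = set is"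
    proof (intro set_eqI iffI)
      fix x assume "x \<in> keys m"
      then show "x \<in> set is" using lk(2)[of x] by (auto simp: in_keys_iff)
    next
      fix x assume "x \<in> set is"
      then obtain k where "k < len \<alpha>" "x = is ! k" using l by (auto simp: in_set_conv_nth)
      then show "x \<in> keys m" using lk(1)[of k] pos[of k] by (simp add: in_keys_iff)
    qed
    have "is": "sorted_list_of_set (keys m) = is"
      unfolding keys using dist \<open>sorted is\<close> by (simp add: sorted_list_of_set_sort_remdups sorted_sort_id distinct_remdups_id)
    moreover have "map (lookup m) is = parts \<alpha>"
      using lk(1) l by (intro nth_equalityI) (auto simp: len_def)
    ultimately show ?thesis
      by (auto intro: composition_eqI simp: parts_flat)
  qed
  have "sorted_list_of_set (keys m) \<in> S" if "flat m = \<alpha>"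
  proof -
    let ?is = "sorted_list_of_set (keys m)"
    have p: "parts \<alpha> = map (lookup m) ?is" using that parts_flat by metis
    then have l: "length ?is = len \<alpha>" by (simp add: len_def)
    have d: "distinct ?is" by simp
    note lk = lookup_sum_single[OF d l, of _ "\<lambda>k. parts \<alpha> ! k"]
    have "m = (\<Sum>k<len \<alpha>. single (?is ! k) (parts \<alpha> ! k))"
    proof (rule poly_mapping_eqI)
      fix x
      show "lookup m x = lookup (\<Sum>k<len \<alpha>. single (?is ! k) (parts \<alpha> ! k)) x"
      proof (cases "x \<in> set ?is")
        case True
        then obtain k where "k < len \<alpha>" "x = ?is ! k" using l by (metis in_set_conv_nth)
        then show ?thesis using lk(1)[of k] p l by simp
      next
        case False
        then show ?thesis using lk(2)[of x] by (simp add: in_keys_iff)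
      qed
    qed
    then show ?thesis using l by (simp add: S_def)
  qed
  with flat have "S = (if flat m = \<alpha> then {sorted_list_of_set (keys m)} else {})"
    by auto
  then show ?thesis
    by (simp add: M_def S_def[symmetric])
qed

lemma M_expansion_eq: "M_expansion c m = lookup c (flat m)"
proof -
  have "M_expansion c m = (\<Sum>\<alpha>\<in>keys c. if \<alpha> = flat m then lookup c \<alpha> else 0)"
    unfolding M_expansion_def M_eq by (intro sum.cong) auto
  then show ?thesis by (simp add: in_keys_iff)
qed

lemma surj_flat: "\<exists>m. flat m = \<alpha>"
proof (induction \<alpha> rule: composition_rev_induct)
  case zero
  show ?case using flat_0 by blast
next
  case (snoc \<alpha> a)
  then obtain m where m: "flat m = \<alpha>" by blast
  \<comment> \<open>A fresh variable above all others carries the new part; the inserted 0 keeps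
    \<open>Max\<close> defined for the monomial 1.\<close>
  have "x < Suc (Max (insert 0 (keys m)))" if "x \<in> keys m" for x
    using that by (simp add: le_imp_less_Suc)
  then show ?case using flat_add m by metis
qed

text \<open>Every composition is \<open>flat\<close> of some monomial, so the coefficients of the
  series determine those of the expansion. This makes the description in \<open>M_coords\<close>
  unique.\<close>

lemma M_expansion_inject: "M_expansion c = M_expansion d \<longleftrightarrow> c = d"
proof
  assume "M_expansion c = M_expansion d"
  then have "lookup c (flat m) = lookup d (flat m)" for m
    using M_expansion_eq by metis
  then show "c = d" using surj_flat by (metis poly_mapping_eqI)
qed simp

lemma M_coords_M_expansion [simp]: "M_coords (M_expansion c) = c"
  by (simp add: M_coords_def M_expansion_inject)

lemma pairing_M_expansion: "pairing h (M_expansion c) = pair h (lookup c)"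
  by (simp add: pairing_def pair_def)

section \<open>Factorizations of monomials and multiplication by \<open>M (ones i)\<close>\<close>

lemma pmap_max_induct [case_names zero add]:
  fixes m :: "nat \<Rightarrow>\<^sub>0 nat"
  assumes "P 0"
    and "\<And>m k a. P m \<Longrightarrow> (\<And>x. x \<in> keys m \<Longrightarrow> x < k) \<Longrightarrow> a > 0 \<Longrightarrow> P (m + single k a)"
  shows "P m"
proof -
  have "\<forall>m. keys m = A \<longrightarrow> P m" if "finite A" for A
    using that
  proof (induction A rule: finite_linorder_max_induct)
    case empty
    then show ?case using assms(1) by auto
  next
    case (insert k A)
    show ?case
    proof (intro allI impI)
      fix m :: "nat \<Rightarrow>\<^sub>0 nat" assume km: "keys m = insert k A"
      define m' where "m' = m - single k (lookup m k)"
      have m: "m = m' + single k (lookup m k)"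
        by (rule poly_mapping_eqI) (auto simp: m'_def lookup_add lookup_minus lookup_single when_def)
      have km': "x \<in> keys m' \<longleftrightarrow> x \<in> keys m \<and> x \<noteq> k" for x
        by (simp add: in_keys_iff m'_def lookup_minus lookup_single when_def)
      have "keys m' = A"
        using insert(2) by (auto simp: km' km)
      have "lookup m k > 0"
        using km by (metis gr0I in_keys_iff insertI1)
      with \<open>keys m' = A\<close> have "P (m' + single k (lookup m k))"
        using insert(2,3) \<open>lookup m k > 0\<close> by (intro assms(2)) auto
      then show "P m" using m by simp
    qed
  qed
  then show ?thesis using finite_keys by blast
qed

text \<open>The variable \<open>k\<close> does not occur in \<open>m\<close>, so a factorization of
  the larger monomial amounts to one of \<open>m\<close> together with a division of the exponent
  \<open>a\<close> into \<open>b\<close> and \<open>a - b\<close>.\<close>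

lemma splits_add_single:
  fixes m :: "nat \<Rightarrow>\<^sub>0 nat"
  assumes "k \<notin> keys m"
  shows "{(p, q). p + q = m + single k a} =
    (\<lambda>((p, q), b). (p + single k b, q + single k (a - b))) ` ({(p, q). p + q = m} \<times> {..a})"
    (is "?L = ?f ` ?R")
proof (intro equalityI subsetI)
  fix z assume "z \<in> ?L"
  then obtain p q where z: "z = (p, q)" and pq: "p + q = m + single k a" by auto
  have lk: "lookup p x + lookup q x = lookup m x + (if x = k then a else 0)" for x
    using arg_cong[OF pq, of "\<lambda>t. lookup t x"] by (auto simp: lookup_add lookup_single when_def)
  have k: "lookup p k + lookup q k = a" using lk[of k] assms by (simp add: in_keys_iff)
  define p' where "p' = p - single k (lookup p k)"
  define q' where "q' = q - single k (lookup q k)"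
  have "p' + q' = m"
    using lk k assms by (intro poly_mapping_eqI)
      (auto simp: p'_def q'_def lookup_add lookup_minus lookup_single when_def in_keys_iff)
  moreover have "p = p' + single k (lookup p k)" "q = q' + single k (a - lookup p k)"
    using k by (auto intro!: poly_mapping_eqI
      simp: p'_def q'_def lookup_add lookup_minus lookup_single when_def)
  ultimately show "z \<in> ?f ` ?R"
    using k z by (intro image_eqI[of _ _ "((p', q'), lookup p k)"]) auto
next
  fix z assume "z \<in> ?f ` ?R"
  then obtain p q b where z: "z = (p + single k b, q + single k (a - b))" "p + q = m" "b \<le> a"
    by auto
  have "p + single k b + (q + single k (a - b)) = m + single k a"
    using z by (intro poly_mapping_eqI) (auto simp: lookup_add lookup_single when_def)
  then show "z \<in> ?L" using z by simp
qed

lemma sum_splits_add_single: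
  fixes m :: "nat \<Rightarrow>\<^sub>0 nat" and g :: "_ \<Rightarrow> _ \<Rightarrow> rat"
  assumes k: "k \<notin> keys m"
  shows "(\<Sum>(p, q) | p + q = m + single k a. g p q) =
    (\<Sum>(p, q) | p + q = m. \<Sum>b\<le>a. g (p + single k b) (q + single k (a - b)))"
proof -
  let ?f = "\<lambda>((p, q), b). (p + single k b, q + single k (a - b))"
  have "inj_on ?f ({(p, q). p + q = m} \<times> {..a})"
  proof (rule inj_onI)
    fix z z' assume z: "z \<in> {(p, q). p + q = m} \<times> {..a}" "z' \<in> {(p, q). p + q = m} \<times> {..a}"
      and f: "?f z = ?f z'"
    obtain p q b where 1: "z = ((p, q), b)" by (metis surj_pair)
    obtain p' q' b' where 2: "z' = ((p', q'), b')" by (metis surj_pair)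
    have eq: "p + q = m" "p' + q' = m" and *: "p + single k b = p' + single k b'"
      and **: "q + single k (a - b) = q' + single k (a - b')"
      using z f by (auto simp: 1 2)
    have "lookup p k = 0" "lookup p' k = 0"
      using k arg_cong[OF eq(1), of "\<lambda>t. lookup t k"] arg_cong[OF eq(2), of "\<lambda>t. lookup t k"]
      by (auto simp: in_keys_iff lookup_add)
    then have b: "b = b'"
      using arg_cong[OF *, of "\<lambda>t. lookup t k"] by (simp add: lookup_add)
    then show "z = z'" using * ** by (simp add: 1 2)
  qed
  then show ?thesis
    unfolding splits_add_single[OF k]
    by (subst sum.reindex, assumption) (simp add: sum.cartesian_product case_prod_unfold)
qed

text \<open>\<open>M (ones i)\<close> is the elementary symmetric function of degree
  \<open>i\<close>.\<close>

definition ones :: "nat \<Rightarrow> composition" where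
  "ones i = Comp (replicate i 1)"

lemma parts_ones [simp]: "parts (ones i) = replicate i 1"
  unfolding ones_def by (rule parts_Comp) auto

lemma add_part_eq_ones:
  "\<alpha> + part b = ones i \<longleftrightarrow> (b = 0 \<and> \<alpha> = ones i) \<or> (b = 1 \<and> i > 0 \<and> \<alpha> = ones (i - 1))"
proof -
  have "xs @ [b] = replicate i 1 \<longleftrightarrow> b = 1 \<and> i > 0 \<and> xs = replicate (i - 1) (1::nat)" for xs
    by (cases i) (auto simp: replicate_append_same[symmetric])
  then show ?thesis
    by (auto simp: parts_inject[symmetric])
qed

text \<open>The list is a word read from its last letter.\<close>

fun vstrip :: "nat \<Rightarrow> nat list \<Rightarrow> nsym" where
  "vstrip i [] = (if i = 0 then 1 else 0)"
| "vstrip i (a # as) = vstrip i as * H (int a) +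
     (if i = 0 then 0 else vstrip (i - 1) as * H (int a - 1))"

abbreviation vstrip_comp :: "nat \<Rightarrow> composition \<Rightarrow> nsym" where
  "vstrip_comp i \<alpha> \<equiv> vstrip i (rev (parts \<alpha>))"

lemma flat_splits:
  assumes "p + q = m" "\<And>x. x \<in> keys m \<Longrightarrow> x < k"
  shows "flat (p + single k a) = flat p + part a" "flat (q + single k a) = flat q + part a"
  using assms(2) unfolding assms(1)[symmetric]
  by (auto intro!: flat_add simp: in_keys_iff lookup_add)

text \<open>A monomial of \<open>M (ones i)\<close> takes each variable at most once. Induction on
  the largest variable follows the recursion of \<open>vstrip\<close>: this variable either gives
  nothing to the first factor, or gives one unit and so lowers the last part by one.\<close>

lemma product_M_ones:
  "(\<Sum>(p, q) | p + q = m. (if flat p = ones i then 1 else 0) * c (flat q)) =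
    pair (vstrip_comp i (flat m)) c"
proof (induction m arbitrary: i c rule: pmap_max_induct)
  case zero
  have "{(p, q). p + q = (0 :: nat \<Rightarrow>\<^sub>0 nat)} = {(0, 0)}"
    by (auto simp: poly_mapping_eq_iff fun_eq_iff lookup_add)
  moreover have "0 = ones i \<longleftrightarrow> i = 0"
    by (auto simp: parts_inject[symmetric])
  ultimately show ?case by simp
next
  case (add m k a)
  then have k: "k \<notin> keys m" by blast
  let ?d = "\<lambda>\<alpha> i. if \<alpha> = ones i then 1 else 0 :: rat"
  have sumb: "(\<Sum>b\<le>a. ?d (\<alpha> + part b) i * c (\<beta> + part (a - b))) =
      ?d \<alpha> i * c (\<beta> + part a) +
      (if i = 0 then 0 else ?d \<alpha> (i - 1) * c (\<beta> + part (a - 1)))" for \<alpha> \<beta>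
  proof -
    have "(\<Sum>b\<le>a. ?d (\<alpha> + part b) i * c (\<beta> + part (a - b))) =
        (\<Sum>b\<in>{0, 1}. ?d (\<alpha> + part b) i * c (\<beta> + part (a - b)))"
      using \<open>a > 0\<close> by (intro sum.mono_neutral_right) (auto simp: add_part_eq_ones)
    then show ?thesis by (auto simp: add_part_eq_ones)
  qed
  have "(\<Sum>(p, q) | p + q = m + single k a. ?d (flat p) i * c (flat q)) =
      (\<Sum>(p, q) | p + q = m. \<Sum>b\<le>a. ?d (flat p + part b) i * c (flat q + part (a - b)))"
    unfolding sum_splits_add_single[OF k]
    by (intro sum.cong) (auto simp: flat_splits[OF _ add(2)])
  also have "\<dots> = (\<Sum>(p, q) | p + q = m. ?d (flat p) i * c (flat q + part a)) +
      (if i = 0 then 0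
       else (\<Sum>(p, q) | p + q = m. ?d (flat p) (i - 1) * c (flat q + part (a - 1))))"
    unfolding sumb by (simp add: sum.distrib case_prod_unfold)
  also have "\<dots> = pair (vstrip_comp i (flat m)) (\<lambda>\<beta>. c (\<beta> + part a)) +
      (if i = 0 then 0
       else pair (vstrip_comp (i - 1) (flat m)) (\<lambda>\<beta>. c (\<beta> + part (a - 1))))"
    using add(1)[of i "\<lambda>\<beta>. c (\<beta> + part a)"] add(1)[of "i - 1" "\<lambda>\<beta>. c (\<beta> + part (a - 1))"]
    by simp
  \<comment> \<open>Since \<open>a > 0\<close>, the lowered index \<open>int a - 1\<close> is
    \<open>int (a - 1)\<close>; for \<open>a = 1\<close> the factor \<open>H 0 = 1\<close> matches
    the empty \<open>part 0\<close>.\<close>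
  also have "\<dots> = pair (vstrip_comp i (flat m + part a)) c"
    using \<open>a > 0\<close> pair_mult_H[of _ "a - 1" c]
    by (simp add: pair_add pair_mult_H of_nat_diff)
  finally show ?case using flat_add[OF add(2)] by simp
qed

subsection \<open>The adjoint of multiplication\<close>

lemma weight_ones [simp]: "weight (ones i) = i"
  by (simp add: weight_def sum_list_replicate)

text \<open>\<open>D (ones i)\<close> is all of \<open>{1..<i}\<close>, so no composition is
  strictly finer.\<close>

lemma F_ones: "F (ones i) = M (ones i)"
proof -
  have "card (D (ones i)) = i - 1" by (simp add: card_D len_def)
  then have D: "D (ones i) = {1..<i}"
    using D_subset[of "ones i"] by (intro card_subset_eq) auto
  have "{\<beta>. finer \<beta> (ones i)} = {ones i}"
  proof (intro set_eqI iffI)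
    fix \<beta> assume "\<beta> \<in> {\<beta>. finer \<beta> (ones i)}"
    then have "weight \<beta> = i" "{1..<i} \<subseteq> D \<beta>" by (auto simp: finer_def D)
    then show "\<beta> \<in> {ones i}" using D_subset[of \<beta>] D by (auto intro!: D_inject)
  qed (auto simp: finer_def)
  then show ?thesis by (simp add: F_def)
qed

lemma pair_neq_0: "pair h c \<noteq> 0 \<Longrightarrow> \<exists>\<alpha>\<in>keys h. c \<alpha> \<noteq> 0"
  by (rule ccontr) (simp add: pair_def)

lemma keys_mult_H: "keys (h * H (int a)) \<subseteq> (\<lambda>\<alpha>. \<alpha> + part a) ` keys h"
  using keys_mult[of h "H (int a)"] by (auto simp: H_nat)

text \<open>Each of the \<open>i\<close> lowered parts loses one unit of weight. Hence only
  compositions of finitely many weights can pair nontrivially with a finitely supported function,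
  which keeps products with \<open>M (ones i)\<close> inside \<open>QSym\<close>.\<close>

lemma keys_vstrip:
  "0 \<notin> set as \<Longrightarrow> \<delta> \<in> keys (vstrip i as) \<Longrightarrow> weight \<delta> + i = sum_list as"
proof (induction "as" arbitrary: i \<delta>)
  case Nil
  then show ?case by (auto split: if_splits)
next
  case (Cons a as)
  have a: "int a - 1 = int (a - 1)" "a > 0" using Cons(2) by auto
  consider "\<delta> \<in> keys (vstrip i as * H (int a))"
    | "i > 0" "\<delta> \<in> keys (vstrip (i - 1) as * H (int (a - 1)))"
    using Cons(3) keys_add[of "vstrip i as * H (int a)" "vstrip (i - 1) as * H (int (a - 1))"]
    unfolding vstrip.simps(2) a(1) by (cases "i = 0") auto
  then show ?case
  proof cases
    case 1
    then obtain \<gamma> where "\<gamma> \<in> keys (vstrip i as)" "\<delta> = \<gamma> + part a"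
      using keys_mult_H by blast
    then show ?thesis using Cons(1)[of \<gamma> i] Cons(2) by auto
  next
    case 2
    then obtain \<gamma> where "\<gamma> \<in> keys (vstrip (i - 1) as)" "\<delta> = \<gamma> + part (a - 1)"
      using keys_mult_H by blast
    then show ?thesis using Cons(1)[of \<gamma> "i - 1"] Cons(2) 2 a(2) by auto
  qed
qed

lemma finite_pair_vstrip:
  assumes "finite {\<beta>. c \<beta> \<noteq> 0}"
  shows "finite {\<gamma>. pair (vstrip_comp i \<gamma>) c \<noteq> 0}"
proof (rule finite_subset)
  show "{\<gamma>. pair (vstrip_comp i \<gamma>) c \<noteq> 0} \<subseteq> (\<Union>\<beta>\<in>{\<beta>. c \<beta> \<noteq> 0}. {\<gamma>. weight \<gamma> = weight \<beta> + i})"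
  proof
    fix \<gamma> assume "\<gamma> \<in> {\<gamma>. pair (vstrip_comp i \<gamma>) c \<noteq> 0}"
    then obtain \<beta> where "\<beta> \<in> keys (vstrip_comp i \<gamma>)" "c \<beta> \<noteq> 0" using pair_neq_0 by blast
    then show "\<gamma> \<in> (\<Union>\<beta>\<in>{\<beta>. c \<beta> \<noteq> 0}. {\<gamma>. weight \<gamma> = weight \<beta> + i})"
      using keys_vstrip[of "rev (parts \<gamma>)" \<beta> i] by (auto simp: weight_def sum_list_rev)
  qed
qed (use assms in auto)

text \<open>The linear extension of \<open>vstrip_comp i\<close>, later identified as the adjoint of
  multiplication by \<open>M (ones i)\<close>.\<close>

definition vert :: "nat \<Rightarrow> nsym \<Rightarrow> nsym" where
  "vert i h = (\<Sum>\<gamma>\<in>keys h. nsym_scale (lookup h \<gamma>) (vstrip_comp i \<gamma>))"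

lemma vert_add: "vert i (x + y) = vert i x + vert i y"
  unfolding vert_def by (rule setsum_keys_plus_distrib) (auto simp: nsym.scale_left_distrib)

lemma vert_single [simp]: "vert i (single \<alpha> r) = nsym_scale r (vstrip_comp i \<alpha>)"
  by (cases "r = 0") (auto simp: vert_def)

lemma vert_0 [simp]: "vert i 0 = 0"
  by (simp add: vert_def)

lemma pair_vert: "pair (vert i h) c = pair h (\<lambda>\<gamma>. pair (vstrip_comp i \<gamma>) c)"
  unfolding vert_def pair_sum pair_scale by (simp add: pair_def[of h])

lemma ps_mult_M_ones:
  "\<exists>d. ps_mult (M (ones i)) (M_expansion c) = M_expansion d \<and>
    lookup d = (\<lambda>\<gamma>. pair (vstrip_comp i \<gamma>) (lookup c))"
proof -
  define d where "d = Abs_poly_mapping (\<lambda>\<gamma>. pair (vstrip_comp i \<gamma>) (lookup c))"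
  have d: "lookup d = (\<lambda>\<gamma>. pair (vstrip_comp i \<gamma>) (lookup c))"
    unfolding d_def by (rule lookup_Abs_poly_mapping) (rule finite_pair_vstrip, simp)
  have "ps_mult (M (ones i)) (M_expansion c) = M_expansion d"
    unfolding ps_mult_def M_eq M_expansion_eq[abs_def] d product_M_ones ..
  then show ?thesis using d by blast
qed

text \<open>The product formula and \<open>pair_vert\<close> give the adjunction. Testing on a
  single \<open>M_\<alpha>\<close> reads off the coefficient at \<open>\<alpha>\<close>, so no other
  element satisfies it, and the definite description in \<open>perp\<close> evaluates to
  \<open>vert i h\<close>.\<close>

lemma perp_F_ones: "perp (F (ones i)) h = vert i h"
proof -
  have *: "pairing h (ps_mult (F (ones i)) (M_expansion c)) = pairing (vert i h) (M_expansion c)" for c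
    using ps_mult_M_ones[of i c] by (auto simp: F_ones pairing_M_expansion pair_vert)
  show ?thesis
    unfolding perp_def
  proof (rule the_equality)
    show "\<forall>g\<in>QSym. pairing (vert i h) g = pairing h (ps_mult (F (ones i)) g)"
      by (auto simp: QSym_def *)
  next
    fix k assume k: "\<forall>g\<in>QSym. pairing k g = pairing h (ps_mult (F (ones i)) g)"
    show "k = vert i h"
    proof (rule poly_mapping_eqI)
      fix \<alpha> :: composition
      have l: "lookup (single \<alpha> 1) = (\<lambda>\<beta>. if \<beta> = \<alpha> then 1 else 0 :: rat)"
        by (auto simp: lookup_single when_def)
      have "pairing k (M_expansion (single \<alpha> 1)) = pairing (vert i h) (M_expansion (single \<alpha> 1))"
        using k by (auto simp: QSym_def *)
      then show "lookup k \<alpha> = lookup (vert i h) \<alpha>"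
        by (simp add: pairing_M_expansion l pair_delta)
    qed
  qed
qed

subsection \<open>Creation operators and the Pieri rule\<close>

lemma nsym_scale_add [simp]: "nsym_scale r (x + y) = nsym_scale r x + nsym_scale r y"
  by (rule nsym.scale_right_distrib)

lemma vert_mult_H:
  assumes "a > 0"
  shows "vert i (h * H (int a)) =
    vert i h * H (int a) + (if i = 0 then 0 else vert (i - 1) h * H (int a - 1))"
proof (induction h rule: nsym_induct)
  case (single \<alpha> r)
  have "single \<alpha> r * H (int a) = single (\<alpha> + part a) r"
    by (simp add: H_nat mult_single)
  then show ?case using assms by (simp add: nsym_scale_mult_left)
next
  case (add x y)
  then show ?case by (simp add: distrib_right vert_add)
qed

lemma vstrip_0: "vstrip_comp 0 \<alpha> = single \<alpha> 1"
proof (induction \<alpha> rule: composition_rev_induct)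
  case (snoc \<alpha> a)
  then show ?case by (simp add: H_nat mult_single)
qed simp

lemma vert_index_0 [simp]: "vert 0 h = h"
  by (induction h rule: nsym_induct) (simp_all add: vert_add vstrip_0 nsym_scale_single)

lemma vstrip_eq_0: "i > length as \<Longrightarrow> vstrip i as = 0"
  by (induction "as" arbitrary: i) auto

text \<open>A word cannot have more factors lowered than it has factors. Hence the series in
  \<open>B\<close> is finite on every element.\<close>

lemma vert_eventually_0: "\<exists>N. \<forall>i\<ge>N. vert i h = 0"
proof (induction h rule: nsym_induct)
  case (single \<alpha> r)
  have "vert i (single \<alpha> r) = 0" if "i \<ge> Suc (len \<alpha>)" for i
    using that by (simp add: vstrip_eq_0 len_def)
  then show ?case by blast
next
  case (add x y)
  then obtain N1 N2 where "\<forall>i\<ge>N1. vert i x = 0" "\<forall>i\<ge>N2. vert i y = 0" by blast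
  then show ?case by (intro exI[of _ "max N1 N2"]) (simp add: vert_add)
qed

lemma B_eq_sum:
  assumes "\<And>i. i \<ge> N \<Longrightarrow> vert i h = 0"
  shows "B m h = (\<Sum>i<N. (- 1) ^ i * H (m + int i) * vert i h)"
  unfolding B_def perp_F_ones[unfolded ones_def]
proof (rule Sum_any.expand_superset)
  show "{i. (- 1) ^ i * H (m + int i) * vert i h \<noteq> 0} \<subseteq> {..<N}"
    using assms by (force simp: not_le[symmetric])
qed simp

lemma B_0 [simp]: "B m 0 = 0"
  using B_eq_sum[of 0 0] by simp

lemma B_add: "B m (x + y) = B m x + B m y"
proof -
  obtain N1 N2 where N: "\<forall>i\<ge>N1. vert i x = 0" "\<forall>i\<ge>N2. vert i y = 0"
    using vert_eventually_0 by blast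
  then have "B m z = (\<Sum>i<max N1 N2. (- 1) ^ i * H (m + int i) * vert i z)" if "z \<in> {x, y, x + y}" for z
    using that by (intro B_eq_sum) (auto simp: vert_add)
  then show ?thesis by (simp add: vert_add distrib_left sum.distrib)
qed

lemma B_sum: "B m (sum f A) = (\<Sum>a\<in>A. B m (f a))"
  by (induction A rule: infinite_finite_induct) (auto simp: B_add)

lemma B_one: "B (int s) 1 = H (int s)"
proof -
  have "vert i 1 = 0" if "i \<ge> 1" for i
    using that vert_single[of i 0 1] by simp
  then have "B (int s) 1 = (\<Sum>i<1. (- 1) ^ i * H (int s + int i) * vert i 1)" by (rule B_eq_sum)
  then show ?thesis by simp
qed

lemma B_index_0_one [simp]: "B 0 1 = 1"
  using B_one[of 0] by (simp add: H_def)

text \<open>Expanding \<open>vert i (h * H (int (Suc s)))\<close> leaves two sums: the first is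
  \<open>B m h * H (int (Suc s))\<close>, the second becomes
  \<open>- (B (m + 1) h * H (int s))\<close> after an index shift.\<close>

lemma B_mult_H_Suc:
  "B m h * H (int (Suc s)) = B m (h * H (int (Suc s))) + B (m + 1) h * H (int s)"
proof -
  obtain N where N: "\<forall>i\<ge>N. vert i h = 0" using vert_eventually_0 by blast
  have 1: "vert i (h * H (int (Suc s))) =
      vert i h * H (int (Suc s)) + (if i = 0 then 0 else vert (i - 1) h * H (int s))" for i
    using vert_mult_H[of "Suc s" i h] by simp
  \<comment> \<open>The bound rises to \<open>Suc N\<close> because term \<open>i\<close> of the
    product also involves \<open>vert (i - 1) h\<close>.\<close>
  have "B m (h * H (int (Suc s))) =
      (\<Sum>i<Suc N. (- 1) ^ i * H (m + int i) * vert i (h * H (int (Suc s))))"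
    using N by (intro B_eq_sum) (auto simp: 1 simp del: of_nat_Suc)
  also have "\<dots> = (\<Sum>i<Suc N. (- 1) ^ i * H (m + int i) * vert i h) * H (int (Suc s)) +
      (\<Sum>i<Suc N. if i = 0 then 0 else (- 1) ^ i * H (m + int i) * vert (i - 1) h * H (int s))"
    unfolding 1 sum_distrib_right sum.distrib[symmetric]
    by (intro sum.cong) (auto simp: distrib_left mult.assoc)
  also have "(\<Sum>i<Suc N. (- 1) ^ i * H (m + int i) * vert i h) = B m h"
    using N by (intro B_eq_sum[symmetric]) auto
  \<comment> \<open>Replacing \<open>i\<close> by \<open>i + 1\<close> flips the sign and moves the
    extra 1 from \<open>i\<close> into \<open>m\<close>.\<close>
  also have "(\<Sum>i<Suc N. if i = 0 then 0 else (- 1) ^ i * H (m + int i) * vert (i - 1) h * H (int s)) =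
      - ((\<Sum>i<N. (- 1) ^ i * H (m + 1 + int i) * vert i h) * H (int s))"
    unfolding sum.lessThan_Suc_shift sum_distrib_right
    by (simp add: sum_negf[symmetric] algebra_simps)
  also have "(\<Sum>i<N. (- 1) ^ i * H (m + 1 + int i) * vert i h) = B (m + 1) h"
    using N by (intro B_eq_sum[symmetric]) auto
  finally show ?thesis by simp
qed

text \<open>Iterating the previous identity splits the \<open>s\<close> boxes: \<open>j\<close> of
  them lengthen the new first row and \<open>s - j\<close> remain for \<open>h\<close>.\<close>

lemma B_mult_H: "B m h * H (int s) = (\<Sum>j\<le>s. B (m + int j) (h * H (int (s - j))))"
proof (induction s arbitrary: m)
  case 0
  then show ?case by (simp add: H_def)
next
  case (Suc s)
  show ?case
    unfolding B_mult_H_Suc Suc.IH sum.atMost_Suc_shift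
    by (simp add: add.assoc add.commute del: of_nat_Suc) (simp add: algebra_simps)
qed

section \<open>The right Pieri rule for immaculate functions\<close>

abbreviation (input) imm :: "nat list \<Rightarrow> nsym" where
  "imm xs \<equiv> immaculate (map int xs)"

lemma immaculate_simps [simp]: "immaculate [] = 1" "immaculate (a # as) = B a (immaculate as)"
  by (simp_all add: immaculate_def)

text \<open>\<open>B 0 1 = 1\<close>, so a bottom row of length 0 is invisible. This lets the Pieri
  rule always append a row, possibly empty.\<close>

lemma immaculate_snoc_0 [simp]: "immaculate (as @ [0]) = immaculate as"
  by (simp add: immaculate_def)

definition pieri :: "nat list \<Rightarrow> nat \<Rightarrow> nat list set" where
  "pieri xs s = {ys. length ys = Suc (length xs) \<and> (\<forall>i<length xs. xs ! i \<le> ys ! i) \<and>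
     sum_list ys = sum_list xs + s}"

lemma pieri_Nil: "pieri [] s = {[s]}"
  by (auto simp: pieri_def length_Suc_conv)

lemma pieri_Cons: "pieri (x # xs) s = (\<Union>j\<le>s. (#) (x + j) ` pieri xs (s - j))"
proof (intro equalityI subsetI)
  fix zs assume zs: "zs \<in> pieri (x # xs) s"
  then obtain y ys where ys: "zs = y # ys" by (cases zs) (auto simp: pieri_def)
  have le: "\<forall>i<length xs. xs ! i \<le> ys ! i" and "x \<le> y" and len: "length ys = Suc (length xs)"
    and sum: "y + sum_list ys = x + sum_list xs + s"
    using zs by (force simp: pieri_def ys All_less_Suc2)+
  \<comment> \<open>The rows below can only grow, so the growth \<open>y - x\<close> of the first
    row is at most \<open>s\<close> and the truncated subtraction is exact.\<close>
  have "sum_list xs \<le> sum_list (take (length xs) ys)"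
    using le len by (auto simp: sum_list_sum_nth atLeast0LessThan intro!: sum_mono)
  also have "\<dots> \<le> sum_list ys" by (metis append_take_drop_id le_add1 sum_list_append)
  finally have "y - x \<le> s" "sum_list ys = sum_list xs + (s - (y - x))"
    using sum \<open>x \<le> y\<close> by linarith+
  then have "ys \<in> pieri xs (s - (y - x))" using le len by (simp add: pieri_def)
  then show "zs \<in> (\<Union>j\<le>s. (#) (x + j) ` pieri xs (s - j))"
    using \<open>y - x \<le> s\<close> \<open>x \<le> y\<close> by (auto simp: ys intro!: bexI[of _ "y - x"])
qed (auto simp: pieri_def All_less_Suc2)

lemma finite_pieri: "finite (pieri xs s)"
  by (induction xs arbitrary: s) (auto simp: pieri_Nil pieri_Cons)

text \<open>\<open>B_mult_H\<close> puts \<open>j\<close> boxes into the first row and hands the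
  remaining \<open>s - j\<close> to the other rows, where the induction hypothesis applies. Distinct
  \<open>j\<close> give distinct first rows, so nothing is counted twice.\<close>

lemma pieri_rule: "imm xs * H (int s) = (\<Sum>ys\<in>pieri xs s. imm ys)"
proof (induction xs arbitrary: s)
  case Nil
  then show ?case by (simp add: pieri_Nil B_one)
next
  case (Cons x xs)
  have "imm (x # xs) * H (int s) = (\<Sum>j\<le>s. \<Sum>ys\<in>pieri xs (s - j). imm ((x + j) # ys))"
    by (simp add: B_mult_H Cons B_sum del: of_nat_diff)
  also have "\<dots> = (\<Sum>j\<le>s. \<Sum>zs\<in>(#) (x + j) ` pieri xs (s - j). imm zs)"
    by (simp add: sum.reindex)
  also have "\<dots> = (\<Sum>zs\<in>pieri (x # xs) s. imm zs)"
    unfolding pieri_Cons by (rule sum.UNION_disjoint[symmetric]) (auto simp: finite_pieri)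
  finally show ?case .
qed

subsection \<open>Triangularity\<close>

lemma lookup_H_mult: "b > 0 \<Longrightarrow> lookup (H (int b) * x) (part b + \<delta>) = lookup x \<delta>"
  by (induction x rule: nsym_induct)
    (auto simp: distrib_left lookup_add H_nat mult_single lookup_single when_def
      simp flip: parts_inject)

lemma lookup_H_mult_neq_0:
  "b > 0 \<Longrightarrow> lookup (H (int b) * x) \<gamma> \<noteq> 0 \<Longrightarrow> \<exists>\<delta>. \<gamma> = part b + \<delta> \<and> lookup x \<delta> \<noteq> 0"
proof -
  assume b: "b > 0" "lookup (H (int b) * x) \<gamma> \<noteq> 0"
  then have "\<gamma> \<in> keys (H (int b) * x)" by (simp add: in_keys_iff)
  then obtain \<delta> where "\<gamma> = part b + \<delta>" using keys_mult[of "H (int b)" x] by (auto simp: H_nat)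
  then show ?thesis using b lookup_H_mult by auto
qed

lemma lookup_sign_mult: "lookup ((- 1) ^ i * x) \<gamma> = (- 1) ^ i * lookup (x :: nsym) \<gamma>"
  by (simp add: minus_one_power_iff)

text \<open>Every word in term \<open>i\<close> of \<open>B (int a)\<close> starts with the letter
  \<open>a + i\<close>. For \<open>i > 0\<close> it is therefore lexicographically larger at once;
  for \<open>i = 0\<close> the operator \<open>vert 0\<close> is the identity and the comparison
  passes to the remaining letters by induction.\<close>

lemma imm_comp_support: "lookup (immaculate_comp \<alpha>) \<delta> \<noteq> 0 \<Longrightarrow> lex_le \<alpha> \<delta>"
  and imm_comp_leading: "lookup (immaculate_comp \<alpha>) \<alpha> = 1"
proof (induction \<alpha> arbitrary: \<delta> rule: composition_induct)
  case zero
  {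
    case 1
    then show ?case by (simp add: lex_le_def)
  next
    case 2
    then show ?case by simp
  }
next
  case (Cons \<alpha> a)
  obtain N where N: "\<forall>i\<ge>N. vert i (immaculate_comp \<alpha>) = 0" using vert_eventually_0 by blast
  have "B (int a) (immaculate_comp \<alpha>) =
      (\<Sum>i<Suc N. (- 1) ^ i * H (int a + int i) * vert i (immaculate_comp \<alpha>))"
    using N by (intro B_eq_sum) auto
  then have eq: "lookup (immaculate_comp (part a + \<alpha>)) \<gamma> =
      (\<Sum>i<Suc N. (- 1) ^ i * lookup (H (int (a + i)) * vert i (immaculate_comp \<alpha>)) \<gamma>)" for \<gamma>
    using \<open>a > 0\<close> by (simp add: lookup_sum lookup_add mult.assoc lookup_sign_mult del: sum.lessThan_Suc)
  {
    case 1
    then obtain i where "lookup (H (int (a + i)) * vert i (immaculate_comp \<alpha>)) \<delta> \<noteq> 0"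
      unfolding eq by (metis (no_types, lifting) mult_zero_right sum.neutral)
    then obtain \<gamma> where \<gamma>: "\<delta> = part (a + i) + \<gamma>" "lookup (vert i (immaculate_comp \<alpha>)) \<gamma> \<noteq> 0"
      using lookup_H_mult_neq_0[of "a + i"] \<open>a > 0\<close> by auto
    then show ?case
      using Cons(1)[of \<gamma>] \<open>a > 0\<close> by (cases "i = 0") (auto simp: lex_le_def)
  next
    case 2
    have "lookup (H (int (a + i)) * vert i (immaculate_comp \<alpha>)) (part a + \<alpha>) = 0" if "i > 0" for i
      using lookup_H_mult_neq_0[of "a + i" _ "part a + \<alpha>"] \<open>a > 0\<close> that
      by (fastforce simp flip: parts_inject)
    then have "lookup (immaculate_comp (part a + \<alpha>)) (part a + \<alpha>) =
        (\<Sum>i<Suc N. if i = 0 then 1 else 0)"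
      unfolding eq using \<open>a > 0\<close> Cons(2) by (intro sum.cong) (auto simp: lookup_H_mult)
    then show ?case by simp
  }
qed

subsection \<open>Restricted growth words\<close>

definition restricted_growth :: "nat list \<Rightarrow> bool" where
  "restricted_growth w \<longleftrightarrow> (\<forall>i<length w. {..<w ! i} \<subseteq> set (take i w))"

text \<open>Positions are counted from 0, so \<open>i\<close> marks the gap between the letters at
  \<open>i - 1\<close> and \<open>i\<close>, that is, between the entries \<open>i\<close> and
  \<open>i + 1\<close> of the tableau.\<close>

definition ascents :: "nat list \<Rightarrow> nat set" where
  "ascents w = {i. 0 < i \<and> i < length w \<and> w ! (i - 1) < w ! i}"

text \<open>The letters of a restricted growth word are exactly those below
  \<open>card (set w)\<close>, so this list is the shape of the tableau with row word
  \<open>w\<close>.\<close>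

definition content :: "nat list \<Rightarrow> nat list" where
  "content w = map (count_list w) [0..<card (set w)]"

definition words :: "composition \<Rightarrow> nat list set" where
  "words \<alpha> = {w. restricted_growth w \<and> length w = weight \<alpha> \<and> ascents w \<subseteq> D \<alpha>}"

lemma downward_closed_nat:
  fixes A :: "nat set"
  assumes "finite A" "\<And>x y. x \<in> A \<Longrightarrow> y < x \<Longrightarrow> y \<in> A"
  shows "A = {..<card A}"
proof (cases "A = {}")
  case False
  have "A = {..Max A}"
  proof (intro equalityI subsetI)
    fix y assume "y \<in> {..Max A}"
    then show "y \<in> A" using assms Max_in[OF assms(1) False] by (cases "y = Max A") auto
  qed (use assms in auto)
  then show ?thesis by (metis card_atMost lessThan_Suc_atMost)
qed simp

lemma set_restricted_growth:
  assumes "restricted_growth w"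
  shows "set w = {..<card (set w)}"
proof (rule downward_closed_nat)
  fix x y assume "x \<in> set w" "y < x"
  then obtain i where "i < length w" "x = w ! i" by (auto simp: in_set_conv_nth)
  then have "y \<in> set (take i w)" using assms \<open>y < x\<close> by (auto simp: restricted_growth_def)
  then show "y \<in> set w" by (rule in_set_takeD)
qed simp

lemma restricted_growth_appendD: "restricted_growth (u @ v) \<Longrightarrow> restricted_growth u"
  unfolding restricted_growth_def
proof (intro allI impI)
  fix i assume *: "\<forall>i<length (u @ v). {..<(u @ v) ! i} \<subseteq> set (take i (u @ v))" "i < length u"
  then show "{..<u ! i} \<subseteq> set (take i u)" using spec[OF *(1), of i] by (simp add: nth_append)
qed

text \<open>The letters of \<open>u\<close> fill \<open>{..<card (set u)}\<close>, so
  \<open>card (set u)\<close> is the first new letter. The first letter of a weakly decreasing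
  \<open>v\<close> bounds all others, so the condition there controls all of
  \<open>v\<close>.\<close>

lemma restricted_growth_append:
  assumes u: "restricted_growth u" and v: "sorted_wrt (\<ge>) v"
  shows "restricted_growth (u @ v) \<longleftrightarrow> set v \<subseteq> {..card (set u)}"
proof
  assume uv: "restricted_growth (u @ v)"
  show "set v \<subseteq> {..card (set u)}"
  proof (cases v)
    case (Cons a as)
    have "{..<(u @ v) ! length u} \<subseteq> set (take (length u) (u @ v))"
      using uv Cons unfolding restricted_growth_def by (metis add_Suc_right length_Cons length_append less_add_Suc1)
    then have "{..<a} \<subseteq> {..<card (set u)}"
      using set_restricted_growth[OF u] Cons by simp
    then have "a \<le> card (set u)" by (simp add: lessThan_subset_iff)
    then show ?thesis using v Cons by auto
  qed simp
next
  assume le: "set v \<subseteq> {..card (set u)}"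
  show "restricted_growth (u @ v)"
    unfolding restricted_growth_def
  proof (intro allI impI)
    fix i assume i: "i < length (u @ v)"
    show "{..<(u @ v) ! i} \<subseteq> set (take i (u @ v))"
    proof (cases "i < length u")
      case True
      then show ?thesis using u by (auto simp: restricted_growth_def nth_append)
    next
      case False
      then have "v ! (i - length u) \<in> set v" using i by (intro nth_mem) auto
      then have "{..<(u @ v) ! i} \<subseteq> {..<card (set u)}" using le False by (auto simp: nth_append)
      also have "\<dots> \<subseteq> set (take i (u @ v))" using set_restricted_growth[OF u] False by auto
      finally show ?thesis .
    qed
  qed
qed

text \<open>The bounding set allows every position inside \<open>u\<close> and the junction, so the
  inclusion only forbids ascents inside \<open>v\<close>.\<close>

lemma ascents_append:
  "ascents (u @ v) \<subseteq> {1..<length u} \<union> {length u} \<longleftrightarrow> sorted_wrt (\<ge>) v"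
proof -
  have tr: "transp ((\<ge>) :: nat \<Rightarrow> nat \<Rightarrow> bool)" by (auto intro: transpI)
  show ?thesis
  proof
    assume *: "ascents (u @ v) \<subseteq> {1..<length u} \<union> {length u}"
    show "sorted_wrt (\<ge>) v"
      unfolding sorted_wrt_iff_nth_Suc_transp[OF tr]
    proof (intro allI impI)
      fix i assume "Suc i < length v"
      then have "length u + Suc i \<notin> ascents (u @ v)" "Suc i < length v" using * by auto
      then show "v ! i \<ge> v ! Suc i" by (simp add: ascents_def nth_append)
    qed
  next
    assume *: "sorted_wrt (\<ge>) v"
    show "ascents (u @ v) \<subseteq> {1..<length u} \<union> {length u}"
    proof
      fix i assume i: "i \<in> ascents (u @ v)"
      have "i \<le> length u"
      proof (rule ccontr)
        assume "\<not> i \<le> length u"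
        then obtain j where j: "i = length u + Suc j" by (metis add_Suc_right less_imp_Suc_add not_le)
        then have "Suc j < length v" "v ! j < v ! Suc j" using i by (auto simp: ascents_def nth_append)
        then show False using * by (auto simp: sorted_wrt_iff_nth_Suc_transp[OF tr] not_le[symmetric])
      qed
      then show "i \<in> {1..<length u} \<union> {length u}" using i by (auto simp: ascents_def)
    qed
  qed
qed

lemma ascents_append_Int: "ascents (u @ v) \<inter> {..<length u} = ascents u"
  by (auto simp: ascents_def nth_append)

text \<open>The bound \<open>m\<close> is inclusive: for \<open>m = card (set u)\<close> the letter
  \<open>m\<close> is the one that opens a new row.\<close>

definition runs :: "nat \<Rightarrow> nat \<Rightarrow> nat list set" where
  "runs s m = {v. length v = s \<and> sorted_wrt (\<ge>) v \<and> set v \<subseteq> {..m}}"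

lemma ascents_append_subset_D:
  assumes "s > 0" "length u = weight \<alpha>"
  shows "ascents (u @ v) \<subseteq> D (\<alpha> + part s) \<longleftrightarrow> ascents u \<subseteq> D \<alpha> \<and> sorted_wrt (\<ge>) v"
proof -
  have "0 \<notin> ascents (u @ v)" by (simp add: ascents_def)
  \<comment> \<open>For \<open>\<alpha> = 0\<close> the junction is position 0, which is not in
    \<open>D\<close> but is never an ascent either.\<close>
  then have "ascents (u @ v) \<subseteq> D (\<alpha> + part s) \<longleftrightarrow> ascents (u @ v) \<subseteq> insert (length u) (D \<alpha>)"
    using assms by (auto simp: D_snoc)
  also have "\<dots> \<longleftrightarrow> ascents (u @ v) \<inter> {..<length u} \<subseteq> D \<alpha> \<and>
      ascents (u @ v) \<subseteq> {1..<length u} \<union> {length u}"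
    using D_subset[of \<alpha>] assms(2) \<open>0 \<notin> ascents (u @ v)\<close> by fastforce
  finally show ?thesis unfolding ascents_append ascents_append_Int .
qed

lemma words_snoc:
  assumes "s > 0"
  shows "words (\<alpha> + part s) = (\<lambda>(u, v). u @ v) ` (SIGMA u:words \<alpha>. runs s (card (set u)))"
    (is "?L = ?f ` ?R")
proof (intro equalityI subsetI)
  fix w assume w: "w \<in> ?L"
  define u v where "u = take (weight \<alpha>) w" and "v = drop (weight \<alpha>) w"
  have uv: "w = u @ v" "length u = weight \<alpha>" "length v = s"
    using w by (auto simp: u_def v_def words_def)
  have "ascents u \<subseteq> D \<alpha> \<and> sorted_wrt (\<ge>) v" "restricted_growth u"
    using w ascents_append_subset_D[OF assms uv(2)] restricted_growth_appendD by (auto simp: words_def uv(1))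
  then have "(u, v) \<in> ?R"
    using w uv restricted_growth_append by (auto simp: words_def runs_def)
  then show "w \<in> ?f ` ?R" using uv(1) by force
next
  fix w assume "w \<in> ?f ` ?R"
  then obtain u v where "w = u @ v" "u \<in> words \<alpha>" "v \<in> runs s (card (set u))" by auto
  then show "w \<in> ?L"
    using ascents_append_subset_D[OF assms] restricted_growth_append by (auto simp: words_def runs_def)
qed

lemma length_content [simp]: "length (content w) = card (set w)"
  by (simp add: content_def)

lemma sum_list_content: "restricted_growth w \<Longrightarrow> sum_list (content w) = length w"
  using sum_count_set[of w "{..<card (set w)}"] set_restricted_growth[of w]
  by (simp add: content_def interv_sum_list_conv_sum_set_nat atLeast0LessThan)

lemma runs_eqI:
  assumes "v \<in> runs s m" "v' \<in> runs s m" "\<And>i. i \<le> m \<Longrightarrow> count_list v i = count_list v' i"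
  shows "v = v'"
proof -
  have "count_list v i = count_list v' i" for i
  proof (cases "i \<le> m")
    case False
    then have "i \<notin> set v" "i \<notin> set v'" using assms(1,2) by (auto simp: runs_def)
    then show ?thesis by simp
  qed (use assms(3) in simp)
  then have "mset v = mset v'" by (intro multiset_eqI) (simp add: count_mset)
  moreover have "sorted (rev v)" "sorted (rev v')"
    using assms by (auto simp: runs_def sorted_wrt_rev)
  ultimately have "rev v = rev v'" by (metis mset_rev properties_for_sort)
  then show ?thesis by simp
qed

text \<open>Appending a run to \<open>u\<close> adds one box to row \<open>i\<close> for each letter
  \<open>i\<close>, including the possible new row \<open>m\<close>. A weakly decreasing run is
  determined by its multiplicities, so runs of length \<open>s\<close> match the Pieri choices one
  to one.\<close>

lemma pieri_content:
  assumes u: "restricted_growth u"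
  defines "m \<equiv> card (set u)"
  shows "bij_betw (\<lambda>v. map (count_list (u @ v)) [0..<Suc m]) (runs s m) (pieri (content u) s)"
    (is "bij_betw ?c _ _")
proof (rule bij_betw_imageI)
  have set_u: "set u = {..<m}" using set_restricted_growth[OF u] by (simp add: m_def)
  show "inj_on ?c (runs s m)"
  proof (rule inj_onI)
    fix v v' assume v: "v \<in> runs s m" "v' \<in> runs s m" and eq: "?c v = ?c v'"
    have "count_list v i = count_list v' i" if "i \<le> m" for i
      using arg_cong[OF eq, of "\<lambda>xs. xs ! i"] that by (simp del: upt_Suc)
    with v show "v = v'" by (rule runs_eqI)
  qed
  show "?c ` runs s m = pieri (content u) s"
  proof (intro equalityI subsetI)
    fix ys assume "ys \<in> ?c ` runs s m"
    then obtain v where v: "v \<in> runs s m" "ys = ?c v" by blast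
    have "set (u @ v) \<subseteq> {..<Suc m}"
      using v set_u by (auto simp: runs_def less_Suc_eq_le)
    from sum_count_set[OF this] have "sum_list ys = length (u @ v)"
      unfolding v(2) interv_sum_list_conv_sum_set_nat atLeastLessThan_upt[symmetric] set_upt atLeast0LessThan
      by simp
    then show "ys \<in> pieri (content u) s"
      using v sum_list_content[OF u]
      by (auto simp: pieri_def runs_def content_def m_def simp del: upt_Suc)
  next
    fix ys assume ys: "ys \<in> pieri (content u) s"
    define d where "d i = ys ! i - count_list u i" for i
    have len: "length ys = Suc m" and le': "\<forall>i<m. count_list u i \<le> ys ! i"
      using ys by (auto simp: pieri_def content_def m_def)
    have "m \<notin> set u" using set_u by simp
    then have le: "count_list u i \<le> ys ! i" if "i \<le> m" for i
      using that le' by (cases "i = m") auto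
    \<comment> \<open>\<open>d i\<close> is the number of boxes that row \<open>i\<close> gains; the
      run consists of \<open>d i\<close> copies of each \<open>i\<close> in weakly decreasing
      order.\<close>
    define A where "A = (\<Sum>i\<le>m. replicate_mset (d i) i)"
    have cA: "count A i = (if i \<le> m then d i else 0)" for i
      by (simp add: A_def count_sum)
    define v where "v = rev (sorted_list_of_multiset A)"
    have mv: "mset v = A" by (simp add: v_def)
    have cv: "count_list v i = (if i \<le> m then d i else 0)" for i
      unfolding count_mset[symmetric] mv cA ..
    have "(\<Sum>i\<le>m. d i) + length u = sum_list ys"
    proof -
      have "set u \<subseteq> {..m}"
        unfolding set_u by (rule subsetI) (simp only: lessThan_iff atMost_iff less_imp_le)
      from sum_count_set[OF this] have "(\<Sum>i\<le>m. d i) + length u = (\<Sum>i\<le>m. d i) + (\<Sum>i\<le>m. count_list u i)"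
        by simp
      also have "\<dots> = (\<Sum>i\<le>m. ys ! i)"
        unfolding sum.distrib[symmetric] using le by (intro sum.cong) (auto simp: d_def)
      finally show ?thesis using len by (simp add: sum_list_sum_nth atLeast0LessThan lessThan_Suc_atMost)
    qed
    then have "size A = s"
      using ys sum_list_content[OF u] by (simp add: A_def size_multiset_sum pieri_def)
    moreover have "set v \<subseteq> {..m}"
    proof
      fix x assume "x \<in> set v"
      then have "count_list v x \<noteq> 0" by (simp add: count_list_0_iff)
      then show "x \<in> {..m}" using cv by (auto split: if_splits)
    qed
    ultimately have "v \<in> runs s m"
      using mv by (auto simp: runs_def v_def sorted_wrt_rev simp flip: size_mset)
    moreover have "?c v = ys"
      using len le by (intro nth_equalityI) (auto simp: cv d_def simp del: upt_Suc)
    ultimately show "ys \<in> ?c ` runs s m" by blast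
  qed
qed

text \<open>The two lists agree if the letter \<open>card (set u)\<close> occurs in
  \<open>v\<close>. Otherwise the right one has an additional last entry 0, which
  \<open>immaculate_snoc_0\<close> removes.\<close>

lemma imm_content_append:
  assumes u: "restricted_growth u" and v: "v \<in> runs s (card (set u))"
  shows "imm (content (u @ v)) = imm (map (count_list (u @ v)) [0..<Suc (card (set u))])"
proof -
  define m where "m = card (set u)"
  have set_u: "set u = {..<m}" using set_restricted_growth[OF u] by (simp add: m_def)
  show ?thesis
  proof (cases "m \<in> set v")
    case True
    then have "set (u @ v) = {..<Suc m}"
      using v set_u unfolding m_def[symmetric] by (auto simp: runs_def less_Suc_eq le_less)
    then have "card (set (u @ v)) = Suc m" by (metis card_lessThan)
    then show ?thesis by (simp add: content_def m_def)
  next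
    case False
    have "x < m" if "x \<in> set v" for x
    proof -
      have "x \<le> m" using v that by (auto simp: runs_def m_def)
      moreover have "x \<noteq> m" using that False by blast
      ultimately show ?thesis by simp
    qed
    then have "set (u @ v) = {..<m}" using set_u by auto
    then have "card (set (u @ v)) = m" by (metis card_lessThan)
    moreover have "count_list (u @ v) m = 0" using False set_u by simp
    ultimately show ?thesis by (simp add: content_def flip: m_def)
  qed
qed

section \<open>Complete and ribbon functions as sums over words\<close>

lemma finite_restricted_growth: "finite {w. restricted_growth w \<and> length w = n}"
proof (rule finite_subset)
  show "{w. restricted_growth w \<and> length w = n} \<subseteq> {w. set w \<subseteq> {..<n} \<and> length w = n}"
  proof clarify
    fix w assume w: "restricted_growth w" and "n = length w"
    have "card (set w) \<le> length w" by (rule card_length)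
    then show "set w \<subseteq> {..<length w} \<and> length w = length w"
      by (subst set_restricted_growth[OF w]) auto
  qed
qed (simp add: finite_lists_length_eq)

lemma finite_words: "finite (words \<alpha>)"
  by (rule finite_subset[OF _ finite_restricted_growth[of "weight \<alpha>"]]) (auto simp: words_def)

text \<open>Induction on the last part: right multiplication by \<open>H (int s)\<close> acts by the
  Pieri rule, and \<open>pieri_content\<close> reads its terms as the runs that extend a
  word.\<close>

lemma H_comp_words: "H_comp \<alpha> = (\<Sum>w\<in>words \<alpha>. imm (content w))"
proof (induction \<alpha> rule: composition_rev_induct)
  case zero
  have "words 0 = {[]}" by (auto simp: words_def restricted_growth_def ascents_def)
  then show ?case by (simp add: H_comp_eq content_def immaculate_def)
next
  case (snoc \<alpha> s)
  have "H_comp (\<alpha> + part s) = H_comp \<alpha> * H (int s)"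
    by (simp add: H_comp_eq H_nat mult_single)
  also have "\<dots> = (\<Sum>u\<in>words \<alpha>. \<Sum>ys\<in>pieri (content u) s. imm ys)"
    by (simp add: snoc(1) sum_distrib_right pieri_rule)
  also have "\<dots> = (\<Sum>u\<in>words \<alpha>. \<Sum>v\<in>runs s (card (set u)). imm (content (u @ v)))"
  proof (rule sum.cong[OF refl])
    fix u assume "u \<in> words \<alpha>"
    then have u: "restricted_growth u" by (simp add: words_def)
    show "(\<Sum>ys\<in>pieri (content u) s. imm ys) = (\<Sum>v\<in>runs s (card (set u)). imm (content (u @ v)))"
      unfolding sum.reindex_bij_betw[OF pieri_content[OF u], symmetric]
      by (intro sum.cong) (simp_all add: imm_content_append[OF u])
  qed
  also have "\<dots> = (\<Sum>(u, v)\<in>(SIGMA u:words \<alpha>. runs s (card (set u))). imm (content (u @ v)))"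
  proof (rule sum.Sigma)
    show "\<forall>u\<in>words \<alpha>. finite (runs s (card (set u)))"
      by (auto simp: runs_def intro: rev_finite_subset[OF finite_lists_length_eq])
  qed (rule finite_words)
  also have "\<dots> = (\<Sum>w\<in>words (\<alpha> + part s). imm (content w))"
  proof -
    have "inj_on (\<lambda>(u, v). u @ v) (SIGMA u:words \<alpha>. runs s (card (set u)))"
      by (auto simp: inj_on_def words_def)
    then show ?thesis
      unfolding words_snoc[OF snoc(2)] by (subst sum.reindex, assumption) (simp add: case_prod_unfold)
  qed
  finally show ?case .
qed

text \<open>By \<open>H_comp_words\<close>, \<open>H_comp \<gamma>\<close> sums over the words with
  ascents contained in \<open>D \<gamma>\<close>. Under \<open>D\<close> the coarser compositions
  correspond to the subsets of \<open>D \<beta>\<close>, so the signed sum defining the ribbon is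
  Moebius inversion over these subsets.\<close>

lemma ribbon_words:
  "ribbon \<beta> = (\<Sum>w | restricted_growth w \<and> length w = weight \<beta> \<and> ascents w = D \<beta>. imm (content w))"
proof -
  define n where "n = weight \<beta>"
  define f where "f S = (\<Sum>w | restricted_growth w \<and> length w = n \<and> ascents w = S. imm (content w))" for S
  define g where "g S = (\<Sum>w | restricted_growth w \<and> length w = n \<and> ascents w \<subseteq> S. imm (content w))" for S
  have "g S = sum f (Pow S)" if "finite S" for S
  proof -
    have "g S = (\<Sum>T\<in>Pow S. \<Sum>w | w \<in> {w. restricted_growth w \<and> length w = n \<and> ascents w \<subseteq> S} \<and> ascents w = T.
        imm (content w))"
      unfolding g_def using that
      by (intro sum.group[symmetric]) (auto intro: rev_finite_subset[OF finite_restricted_growth[of n]])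
    also have "\<dots> = sum f (Pow S)"
      unfolding f_def by (intro sum.cong) (auto intro!: sum.cong)
    finally show ?thesis .
  qed
  then have "f (D \<beta>) = (\<Sum>T\<in>Pow (D \<beta>). (- 1) ^ (card (D \<beta>) - card T) * g T)"
    by (rule inclusion_exclusion_mobius) simp_all
  also have "\<dots> = (\<Sum>\<gamma> | finer \<beta> \<gamma>. (- 1) ^ (card (D \<beta>) - card (D \<gamma>)) * g (D \<gamma>))"
  proof (rule sum.reindex_bij_betw[symmetric], rule bij_betw_imageI)
    show "inj_on D {\<gamma>. finer \<beta> \<gamma>}" by (auto simp: inj_on_def finer_def intro: D_inject)
    show "D ` {\<gamma>. finer \<beta> \<gamma>} = Pow (D \<beta>)"
    proof (intro equalityI subsetI)
      fix S assume "S \<in> Pow (D \<beta>)"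
      then obtain \<gamma> where "weight \<gamma> = weight \<beta>" "D \<gamma> = S"
        using ex_composition_D[of S "weight \<beta>"] D_subset[of \<beta>] by auto
      then show "S \<in> D ` {\<gamma>. finer \<beta> \<gamma>}" using \<open>S \<in> Pow (D \<beta>)\<close> by (auto simp: finer_def)
    qed (auto simp: finer_def)
  qed
  also have "\<dots> = ribbon \<beta>"
    unfolding ribbon_def
  proof (rule sum.cong[OF refl])
    fix \<gamma> assume "\<gamma> \<in> {\<gamma>. finer \<beta> \<gamma>}"
    then have w: "weight \<gamma> = weight \<beta>" by (simp add: finer_def)
    have "g (D \<gamma>) = H_comp \<gamma>" by (simp add: g_def H_comp_words words_def n_def w)
    \<comment> \<open>The truncated \<open>len - 1\<close> in the size of \<open>D\<close> cancels
      in the difference for nonempty \<open>\<gamma>\<close>; an empty \<open>\<gamma>\<close>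
      forces an empty \<open>\<beta>\<close>.\<close>
    moreover have "card (D \<beta>) - card (D \<gamma>) = len \<beta> - len \<gamma>"
    proof (cases "\<gamma> = 0")
      case True
      then have "\<beta> = 0" using w by (metis weight_eq_0)
      then show ?thesis using True by simp
    next
      case False
      then have "len \<gamma> > 0" by (simp add: len_def)
      then show ?thesis by (simp add: card_D)
    qed
    ultimately show "(- 1) ^ (card (D \<beta>) - card (D \<gamma>)) * g (D \<gamma>) = (- 1) ^ (len \<beta> - len \<gamma>) * H_comp \<gamma>"
      by simp
  qed
  finally show ?thesis by (simp add: f_def n_def)
qed

subsection \<open>Tableaux as words\<close>

definition row_word :: "composition \<Rightarrow> (nat \<times> nat \<Rightarrow> nat) \<Rightarrow> nat list" where
  "row_word \<alpha> T = map (\<lambda>i. fst (the_inv_into (diagram \<alpha>) T (Suc i))) [0..<weight \<alpha>]"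

lemma length_row_word [simp]: "length (row_word \<alpha> T) = weight \<alpha>"
  by (simp add: row_word_def)

lemma count_list_eq_card: "count_list xs y = card {i. i < length xs \<and> xs ! i = y}"
  by (simp add: count_list_eq_length_filter length_filter_conv_card) (metis (full_types))

lemma diagram_first: "(j, c) \<in> diagram \<alpha> \<Longrightarrow> (j, 0) \<in> diagram \<alpha>"
  by (auto simp: diagram_def)

lemma parts_pos: "j < len \<alpha> \<Longrightarrow> parts \<alpha> ! j > 0"
  using zero_notin_parts[of \<alpha>] by (metis gr0I len_def nth_mem)

lemma
  assumes T: "T \<in> standard_immaculate_tableaux \<alpha>"
  shows tableau_inj: "inj_on T (diagram \<alpha>)"
    and tableau_image: "T ` diagram \<alpha> = {1..weight \<alpha>}"
    and tableau_row: "(j, c) \<in> diagram \<alpha> \<Longrightarrow> (j, c') \<in> diagram \<alpha> \<Longrightarrow> c < c' \<Longrightarrow> T (j, c) < T (j, c')"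
    and tableau_column: "(j, 0) \<in> diagram \<alpha> \<Longrightarrow> (j', 0) \<in> diagram \<alpha> \<Longrightarrow> j < j' \<Longrightarrow> T (j, 0) < T (j', 0)"
    and tableau_extensional: "T \<in> extensional (diagram \<alpha>)"
  using T by (auto simp: standard_immaculate_tableaux_def bij_betw_def)

lemma row_word_nth:
  assumes "T \<in> standard_immaculate_tableaux \<alpha>" "(j, c) \<in> diagram \<alpha>" "T (j, c) = Suc i"
  shows "i < weight \<alpha>" "row_word \<alpha> T ! i = j"
proof -
  have "Suc i \<in> {1..weight \<alpha>}" using tableau_image[OF assms(1)] assms(2,3) by (metis imageI)
  then show "i < weight \<alpha>" by simp
  moreover have "the_inv_into (diagram \<alpha>) T (Suc i) = (j, c)"
    using the_inv_into_f_f[OF tableau_inj[OF assms(1)] assms(2)] assms(3) by simp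
  ultimately show "row_word \<alpha> T ! i = j" by (simp add: row_word_def)
qed

lemma tableau_cell:
  assumes "T \<in> standard_immaculate_tableaux \<alpha>" "i < weight \<alpha>"
  obtains c where "(row_word \<alpha> T ! i, c) \<in> diagram \<alpha>" "T (row_word \<alpha> T ! i, c) = Suc i"
proof -
  have "Suc i \<in> T ` diagram \<alpha>" using tableau_image[OF assms(1)] assms(2) by simp
  then obtain j c where "(j, c) \<in> diagram \<alpha>" "T (j, c) = Suc i" by (metis imageE surj_pair)
  then show ?thesis using that row_word_nth[OF assms(1)] by metis
qed

text \<open>Counting both sides recovers the shape from the row word, and sorting them recovers the
  rows; \<open>count_row_word\<close> and \<open>row_word_inj\<close> rest on this.\<close>

lemma row_entries:
  assumes T: "T \<in> standard_immaculate_tableaux \<alpha>" and j: "j < len \<alpha>"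
  shows "(\<lambda>c. T (j, c)) ` {..<parts \<alpha> ! j} = Suc ` {i. i < weight \<alpha> \<and> row_word \<alpha> T ! i = j}"
proof (intro equalityI subsetI)
  fix t assume "t \<in> (\<lambda>c. T (j, c)) ` {..<parts \<alpha> ! j}"
  then obtain c where c: "(j, c) \<in> diagram \<alpha>" "t = T (j, c)" using j by (auto simp: diagram_def)
  then have "t \<in> {1..weight \<alpha>}" using tableau_image[OF T] by blast
  then obtain i where "t = Suc i" by (cases t) auto
  then show "t \<in> Suc ` {i. i < weight \<alpha> \<and> row_word \<alpha> T ! i = j}"
    using row_word_nth[OF T c(1)] c(2) by auto
next
  fix t assume "t \<in> Suc ` {i. i < weight \<alpha> \<and> row_word \<alpha> T ! i = j}"
  then obtain i where i: "t = Suc i" "i < weight \<alpha>" "row_word \<alpha> T ! i = j" by blast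
  obtain c where "(j, c) \<in> diagram \<alpha>" "T (j, c) = Suc i" using tableau_cell[OF T i(2)] i(3) by metis
  then show "t \<in> (\<lambda>c. T (j, c)) ` {..<parts \<alpha> ! j}" using i(1) by (force simp: diagram_def)
qed

lemma count_row_word:
  assumes T: "T \<in> standard_immaculate_tableaux \<alpha>" and j: "j < len \<alpha>"
  shows "count_list (row_word \<alpha> T) j = parts \<alpha> ! j"
proof -
  have "inj_on (\<lambda>c. T (j, c)) {..<parts \<alpha> ! j}"
    using tableau_inj[OF T] j by (auto simp: inj_on_def diagram_def)
  then have "parts \<alpha> ! j = card ((\<lambda>c. T (j, c)) ` {..<parts \<alpha> ! j})" by (simp add: card_image)
  also have "\<dots> = count_list (row_word \<alpha> T) j"
    unfolding row_entries[OF T j] by (simp add: card_image count_list_eq_card)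
  finally show ?thesis ..
qed

lemma set_row_word:
  assumes T: "T \<in> standard_immaculate_tableaux \<alpha>"
  shows "set (row_word \<alpha> T) = {..<len \<alpha>}"
proof (intro equalityI subsetI)
  fix j assume "j \<in> set (row_word \<alpha> T)"
  then obtain i where i: "i < weight \<alpha>" "j = row_word \<alpha> T ! i" by (auto simp: in_set_conv_nth)
  then obtain c where "(j, c) \<in> diagram \<alpha>" using tableau_cell[OF T i(1)] by metis
  then show "j \<in> {..<len \<alpha>}" by (simp add: diagram_def)
next
  fix j assume "j \<in> {..<len \<alpha>}"
  then have "count_list (row_word \<alpha> T) j \<noteq> 0" using count_row_word[OF T] parts_pos by simp
  then show "j \<in> set (row_word \<alpha> T)" by (simp add: count_list_0_iff)
qed

lemma content_row_word:
  assumes "T \<in> standard_immaculate_tableaux \<alpha>"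
  shows "content (row_word \<alpha> T) = parts \<alpha>"
  by (rule nth_equalityI)
    (use assms in \<open>auto simp: content_def set_row_word count_row_word len_def\<close>)

text \<open>Let the entry \<open>Suc i\<close> lie below row \<open>j\<close>. The first entry of
  row \<open>j\<close> is smaller than the first entry of the row of \<open>Suc i\<close>, which is
  at most \<open>Suc i\<close>. So the letter \<open>j\<close> occurs before position
  \<open>i\<close>.\<close>

lemma restricted_growth_row_word:
  assumes T: "T \<in> standard_immaculate_tableaux \<alpha>"
  shows "restricted_growth (row_word \<alpha> T)"
  unfolding restricted_growth_def
proof (intro allI impI subsetI)
  fix i j assume "i < length (row_word \<alpha> T)" and "j \<in> {..<row_word \<alpha> T ! i}"
  then have i: "i < weight \<alpha>" and j: "j < row_word \<alpha> T ! i" by simp_all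
  obtain c where c: "(row_word \<alpha> T ! i, c) \<in> diagram \<alpha>" "T (row_word \<alpha> T ! i, c) = Suc i"
    using tableau_cell[OF T i] .
  have first: "(row_word \<alpha> T ! i, 0) \<in> diagram \<alpha>" using c(1) by (rule diagram_first)
  have j0: "(j, 0) \<in> diagram \<alpha>" using first j parts_pos by (auto simp: diagram_def)
  have "T (j, 0) < T (row_word \<alpha> T ! i, 0)" by (rule tableau_column[OF T j0 first j])
  also have "\<dots> \<le> Suc i"
    using tableau_row[OF T first c(1)] c(2) by (cases "c = 0") auto
  finally have lt: "T (j, 0) < Suc i" .
  have "T (j, 0) \<in> {1..weight \<alpha>}" using tableau_image[OF T] j0 by blast
  then obtain i' where i': "T (j, 0) = Suc i'" by (cases "T (j, 0)") auto
  have "i' < i" "row_word \<alpha> T ! i' = j" using lt i' row_word_nth[OF T j0 i'] by auto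
  then show "j \<in> set (take i (row_word \<alpha> T))"
    using i by (auto simp: in_set_conv_nth intro!: exI[of _ i'])
qed

lemma descents_eq_ascents:
  assumes T: "T \<in> standard_immaculate_tableaux \<alpha>"
  shows "descents \<alpha> T = ascents (row_word \<alpha> T)"
proof (intro equalityI subsetI)
  fix i assume "i \<in> descents \<alpha> T"
  then obtain j c j' c' where *: "(j, c) \<in> diagram \<alpha>" "(j', c') \<in> diagram \<alpha>"
    "T (j, c) = i" "T (j', c') = Suc i" "j < j'" by (auto simp: descents_def)
  have "i \<in> {1..weight \<alpha>}" using tableau_image[OF T] *(1,3) by blast
  then have "T (j, c) = Suc (i - 1)" "i > 0" using *(3) by auto
  then show "i \<in> ascents (row_word \<alpha> T)"
    using row_word_nth[OF T *(1), of "i - 1"] row_word_nth[OF T *(2) *(4)] *(5) by (simp add: ascents_def)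
next
  fix i assume "i \<in> ascents (row_word \<alpha> T)"
  then have i: "0 < i" "i < weight \<alpha>" "row_word \<alpha> T ! (i - 1) < row_word \<alpha> T ! i"
    by (auto simp: ascents_def)
  obtain c where "(row_word \<alpha> T ! i, c) \<in> diagram \<alpha>" "T (row_word \<alpha> T ! i, c) = i + 1"
    using tableau_cell[OF T i(2)] by auto
  moreover obtain c' where "(row_word \<alpha> T ! (i - 1), c') \<in> diagram \<alpha>" "T (row_word \<alpha> T ! (i - 1), c') = i"
  proof -
    have "i - 1 < weight \<alpha>" "Suc (i - 1) = i" using i by auto
    then show ?thesis using tableau_cell[OF T, of "i - 1"] that by metis
  qed
  ultimately show "i \<in> descents \<alpha> T" using i(3) unfolding descents_def by blast
qed

lemma row_word_inj: "inj_on (row_word \<alpha>) (standard_immaculate_tableaux \<alpha>)"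
proof (rule inj_onI)
  fix T T' assume T: "T \<in> standard_immaculate_tableaux \<alpha>" and T': "T' \<in> standard_immaculate_tableaux \<alpha>"
    and eq: "row_word \<alpha> T = row_word \<alpha> T'"
  have srt: "sorted_wrt (<) (map (\<lambda>c. S (j, c)) [0..<parts \<alpha> ! j])"
    if "S \<in> standard_immaculate_tableaux \<alpha>" "j < len \<alpha>" for S j
    using tableau_row[OF that(1)] that(2) by (auto simp: sorted_wrt_iff_nth_less diagram_def)
  show "T = T'"
  proof (rule extensionalityI)
    show "T \<in> extensional (diagram \<alpha>)" "T' \<in> extensional (diagram \<alpha>)"
      using T T' tableau_extensional by blast+
    fix x assume x: "x \<in> diagram \<alpha>"
    obtain j c where jc: "x = (j, c)" "j < len \<alpha>" "c < parts \<alpha> ! j"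
      using x by (auto simp: diagram_def)
    have "map (\<lambda>c. T (j, c)) [0..<parts \<alpha> ! j] = map (\<lambda>c. T' (j, c)) [0..<parts \<alpha> ! j]"
    proof (rule strict_sorted_equal[OF srt[OF T' jc(2)] srt[OF T jc(2)]])
      show "set (map (\<lambda>c. T (j, c)) [0..<parts \<alpha> ! j]) = set (map (\<lambda>c. T' (j, c)) [0..<parts \<alpha> ! j])"
        using row_entries[OF T jc(2)] row_entries[OF T' jc(2)] eq by (simp add: atLeast0LessThan)
    qed
    then show "T x = T' x" using jc by (auto simp: map_eq_conv)
  qed
qed

lemma row_word_surj:
  assumes rg: "restricted_growth w" and cont: "content w = parts \<alpha>"
  shows "\<exists>T\<in>standard_immaculate_tableaux \<alpha>. row_word \<alpha> T = w"
proof -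
  \<comment> \<open>\<open>P j\<close> collects the positions of the letter \<open>j\<close>; listed
    increasingly and raised by one, they fill row \<open>j\<close>.\<close>
  define P where "P j = {i. i < length w \<and> w ! i = j}" for j
  define row where "row j = sorted_list_of_set (P j)" for j
  define T where "T = restrict (\<lambda>(j, c). Suc (row j ! c)) (diagram \<alpha>)"
  have wt: "weight \<alpha> = length w" using sum_list_content[OF rg] cont by (simp add: weight_def)
  have len: "len \<alpha> = card (set w)" using arg_cong[OF cont, of length] by (simp add: len_def)
  have fin: "finite (P j)" for j by (simp add: P_def)
  have set_row: "set (row j) = P j" for j by (simp add: row_def fin)
  have srt: "sorted_wrt (<) (row j)" for j by (simp add: row_def)
  have len_row: "length (row j) = parts \<alpha> ! j" if "j < len \<alpha>" for j
  proof -
    have "length (row j) = count_list w j" by (simp add: row_def count_list_eq_card P_def)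
    also have "\<dots> = content w ! j" using that by (simp add: content_def len)
    finally show ?thesis by (simp add: cont)
  qed
  have row: "row j ! c < length w" "w ! (row j ! c) = j" if "(j, c) \<in> diagram \<alpha>" for j c
  proof -
    have "row j ! c \<in> P j" using that len_row set_row by (metis (no_types, lifting) case_prodD diagram_def mem_Collect_eq nth_mem)
    then show "row j ! c < length w" "w ! (row j ! c) = j" by (auto simp: P_def)
  qed
  have T_eq: "T (j, c) = Suc (row j ! c)" if "(j, c) \<in> diagram \<alpha>" for j c
    using that by (simp add: T_def)
  have cell: "\<exists>c. (w ! i, c) \<in> diagram \<alpha> \<and> row (w ! i) ! c = i" if "i < length w" for i
  proof -
    have "i \<in> set (row (w ! i))" using that by (simp add: set_row P_def)
    then obtain c where "c < length (row (w ! i))" "row (w ! i) ! c = i" by (metis in_set_conv_nth)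
    moreover have "w ! i < len \<alpha>" using that set_restricted_growth[OF rg] len by (metis lessThan_iff nth_mem)
    ultimately show ?thesis using len_row by (auto simp: diagram_def)
  qed
  have "inj_on T (diagram \<alpha>)"
  proof (rule inj_onI)
    fix x y assume x: "x \<in> diagram \<alpha>" and y: "y \<in> diagram \<alpha>" and eq: "T x = T y"
    obtain j c where 1: "x = (j, c)" by (cases x)
    obtain j' c' where 2: "y = (j', c')" by (cases y)
    have r: "row j ! c = row j' ! c'" using eq x y by (simp add: T_eq 1 2)
    then have "j = j'" using row[of j c] row[of j' c'] x y 1 2 by metis
    moreover have "distinct (row j)" by (simp add: row_def)
    ultimately have "c = c'"
      using r x y len_row 1 2 by (auto simp: diagram_def nth_eq_iff_index_eq)
    then show "x = y" using \<open>j = j'\<close> 1 2 by simp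
  qed
  moreover have "T ` diagram \<alpha> = {1..weight \<alpha>}"
  proof (intro equalityI subsetI)
    fix t assume "t \<in> T ` diagram \<alpha>"
    then obtain j c where jc: "(j, c) \<in> diagram \<alpha>" "t = Suc (row j ! c)" using T_eq by force
    then show "t \<in> {1..weight \<alpha>}" using row(1)[OF jc(1)] by (simp add: wt)
  next
    fix t assume "t \<in> {1..weight \<alpha>}"
    then obtain i where i: "t = Suc i" "i < length w" using wt by (cases t) auto
    then obtain c where c: "(w ! i, c) \<in> diagram \<alpha>" "row (w ! i) ! c = i" using cell by blast
    then show "t \<in> T ` diagram \<alpha>" using T_eq[OF c(1)] i(1) by (metis imageI)
  qed
  moreover have "T (j, c) < T (j, c')"
    if "(j, c) \<in> diagram \<alpha>" "(j, c') \<in> diagram \<alpha>" "c < c'" for j c c'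
    using sorted_wrt_nth_less[OF srt[of j] that(3)] that len_row by (auto simp: T_eq) (auto simp: diagram_def)
  moreover have "T (j, 0) < T (j', 0)"
    if "(j, 0) \<in> diagram \<alpha>" "(j', 0) \<in> diagram \<alpha>" "j < j'" for j j'
  proof -
    \<comment> \<open>\<open>row j' ! 0\<close> is the first position of the letter
      \<open>j'\<close>; all smaller letters, in particular \<open>j\<close>, occur before
      it.\<close>
    have "{..<j'} \<subseteq> set (take (row j' ! 0) w)"
      using rg row[OF that(2)] unfolding restricted_growth_def by metis
    then have "j \<in> set (take (row j' ! 0) w)" using that(3) by blast
    then obtain i where i: "i < row j' ! 0" "i < length w" "w ! i = j"
      by (auto simp: in_set_conv_nth)
    then obtain c where c: "(j, c) \<in> diagram \<alpha>" "row j ! c = i" using cell by blast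
    have "row j ! 0 \<le> row j ! c"
      using sorted_wrt_nth_less[OF srt[of j], of 0 c] c(1) len_row by (cases "c = 0") (auto simp: diagram_def)
    then show ?thesis using i(1) c(2) that by (simp add: T_eq)
  qed
  ultimately have T: "T \<in> standard_immaculate_tableaux \<alpha>"
    by (auto simp: standard_immaculate_tableaux_def bij_betw_def T_def)
  have "row_word \<alpha> T = w"
  proof (rule nth_equalityI)
    fix i assume "i < length (row_word \<alpha> T)"
    then obtain c where "(w ! i, c) \<in> diagram \<alpha>" "row (w ! i) ! c = i" using cell wt by auto
    then show "row_word \<alpha> T ! i = w ! i" using row_word_nth(2)[OF T] T_eq by metis
  qed (simp add: wt)
  with T show ?thesis by blast
qed

lemma descent_composition_eq:
  assumes T: "T \<in> standard_immaculate_tableaux \<alpha>" and w: "weight \<alpha> = weight \<beta>"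
  shows "descent_composition \<alpha> T = \<beta> \<longleftrightarrow> ascents (row_word \<alpha> T) = D \<beta>"
proof -
  have "ascents (row_word \<alpha> T) \<subseteq> {1..<weight \<alpha>}" by (auto simp: ascents_def)
  then obtain \<gamma> where \<gamma>: "weight \<gamma> = weight \<alpha>" "D \<gamma> = descents \<alpha> T"
    using ex_composition_D descents_eq_ascents[OF T] by metis
  then have "descent_composition \<alpha> T = \<gamma>"
    unfolding descent_composition_def by (intro the_equality) (auto intro: D_inject)
  then show ?thesis using \<gamma> w descents_eq_ascents[OF T] D_inject by metis
qed

lemma L_eq_card_words:
  assumes w: "weight \<alpha> = weight \<beta>"
  shows "L \<alpha> \<beta> = card {w. restricted_growth w \<and> length w = weight \<beta> \<and> ascents w = D \<beta> \<and> content w = parts \<alpha>}"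
proof -
  have "bij_betw (row_word \<alpha>) {T \<in> standard_immaculate_tableaux \<alpha>. descent_composition \<alpha> T = \<beta>}
    {w. restricted_growth w \<and> length w = weight \<beta> \<and> ascents w = D \<beta> \<and> content w = parts \<alpha>}"
    (is "bij_betw _ ?A ?W")
  proof (rule bij_betw_imageI)
    show "inj_on (row_word \<alpha>) ?A" by (rule inj_on_subset[OF row_word_inj]) auto
    show "row_word \<alpha> ` ?A = ?W"
    proof (intro equalityI subsetI)
      fix v assume "v \<in> row_word \<alpha> ` ?A"
      then obtain T where T: "T \<in> standard_immaculate_tableaux \<alpha>" "v = row_word \<alpha> T"
        "descent_composition \<alpha> T = \<beta>" by blast
      then have "ascents v = D \<beta>" using descent_composition_eq[OF T(1) w] by simp
      then show "v \<in> ?W"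
        using w T(2) restricted_growth_row_word[OF T(1)] content_row_word[OF T(1)] by simp
    next
      fix v assume v: "v \<in> ?W"
      then obtain T where T: "T \<in> standard_immaculate_tableaux \<alpha>" "row_word \<alpha> T = v"
        using row_word_surj by blast
      then have "descent_composition \<alpha> T = \<beta>" using descent_composition_eq[OF T(1) w] v by auto
      then show "v \<in> row_word \<alpha> ` ?A" using T by blast
    qed
  qed
  then show ?thesis unfolding L_def by (rule bij_betw_same_card)
qed

subsection \<open>Expansion of ribbons\<close>

lemma nsym_scale_of_nat: "nsym_scale (of_nat n) x = of_nat n * x"
  by (induction n) (simp_all add: nsym.scale_left_distrib distrib_right)

lemma zero_notin_content:
  assumes "restricted_growth w"
  shows "0 \<notin> set (content w)"
proof
  assume "0 \<in> set (content w)"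
  then obtain i where "i < card (set w)" "i \<notin> set w" by (auto simp: content_def count_list_0_iff)
  then show False using set_restricted_growth[OF assms] by blast
qed

text \<open>Grouping the words by content turns multiplicities into \<open>L\<close>. The
  lexicographic restriction is added once the remaining coefficients are known to vanish.\<close>

lemma ribbon_expansion:
  "ribbon \<beta> = (\<Sum>\<alpha> | weight \<alpha> = weight \<beta>. nsym_scale (of_nat (L \<alpha> \<beta>)) (immaculate_comp \<alpha>))"
proof -
  define W where "W = {w. restricted_growth w \<and> length w = weight \<beta> \<and> ascents w = D \<beta>}"
  have W: "finite W"
    by (rule finite_subset[OF _ finite_restricted_growth[of "weight \<beta>"]]) (auto simp: W_def)
  have c: "Comp (content w) = \<alpha> \<longleftrightarrow> content w = parts \<alpha>" if "w \<in> W" for w \<alpha>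
    using that zero_notin_content[of w] by (auto simp: W_def parts_Comp parts_inverse)
  have "(\<lambda>w. Comp (content w)) ` W \<subseteq> {\<alpha>. weight \<alpha> = weight \<beta>}"
    using zero_notin_content sum_list_content by (auto simp: W_def weight_def parts_Comp)
  then have "ribbon \<beta> = (\<Sum>\<alpha> | weight \<alpha> = weight \<beta>. \<Sum>w | w \<in> W \<and> Comp (content w) = \<alpha>. imm (content w))"
    unfolding ribbon_words W_def[symmetric] using W by (intro sum.group[symmetric]) auto
  also have "\<dots> = (\<Sum>\<alpha> | weight \<alpha> = weight \<beta>. nsym_scale (of_nat (L \<alpha> \<beta>)) (immaculate_comp \<alpha>))"
  proof (rule sum.cong[OF refl])
    fix \<alpha> assume "\<alpha> \<in> {\<alpha>. weight \<alpha> = weight \<beta>}"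
    then have "L \<alpha> \<beta> = card {w. w \<in> W \<and> Comp (content w) = \<alpha>}"
      using c by (simp add: L_eq_card_words W_def) (metis (mono_tags, lifting))
    moreover have "(\<Sum>w | w \<in> W \<and> Comp (content w) = \<alpha>. imm (content w)) =
        (\<Sum>w | w \<in> W \<and> Comp (content w) = \<alpha>. immaculate_comp \<alpha>)"
    proof (rule sum.cong[OF refl])
      fix w assume "w \<in> {w. w \<in> W \<and> Comp (content w) = \<alpha>}"
      then have "content w = parts \<alpha>" using c by blast
      then show "imm (content w) = immaculate_comp \<alpha>" by simp
    qed
    ultimately show "(\<Sum>w | w \<in> W \<and> Comp (content w) = \<alpha>. imm (content w)) =
        nsym_scale (of_nat (L \<alpha> \<beta>)) (immaculate_comp \<alpha>)"
      by (simp add: nsym_scale_of_nat)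
  qed
  finally show ?thesis .
qed

section \<open>The immaculate functions form a basis\<close>

lemma lex_le_antisym: "lex_le \<alpha> \<beta> \<Longrightarrow> lex_le \<beta> \<alpha> \<Longrightarrow> \<alpha> = \<beta>"
  unfolding lex_le_def by (intro composition_eqI lexordp_eq_antisym)

lemma lex_le_trans: "lex_le \<alpha> \<beta> \<Longrightarrow> lex_le \<beta> \<gamma> \<Longrightarrow> lex_le \<alpha> \<gamma>"
  unfolding lex_le_def by (rule lexordp_eq_trans)

lemma ex_lex_minimal:
  assumes "finite A" "A \<noteq> {}"
  obtains \<mu> where "\<mu> \<in> A" "\<And>\<alpha>. \<alpha> \<in> A \<Longrightarrow> lex_le \<alpha> \<mu> \<Longrightarrow> \<alpha> = \<mu>"
proof -
  have "\<exists>\<mu>\<in>A. \<forall>\<alpha>\<in>A. \<alpha> \<noteq> \<mu> \<longrightarrow> \<not> (lex_le \<alpha> \<mu> \<and> \<alpha> \<noteq> \<mu>)"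
  proof (rule Finite_Set.bex_min_element[OF assms(1) _ _ assms(2)])
    show "asymp_on A (\<lambda>\<alpha> \<mu>. lex_le \<alpha> \<mu> \<and> \<alpha> \<noteq> \<mu>)"
      using lex_le_antisym by (auto simp: asymp_on_def)
    show "transp_on A (\<lambda>\<alpha> \<mu>. lex_le \<alpha> \<mu> \<and> \<alpha> \<noteq> \<mu>)"
      using lex_le_antisym lex_le_trans by (intro transp_onI) metis
  qed
  then show ?thesis using that by blast
qed

text \<open>By triangularity only indices lexicographically at most \<open>\<mu>\<close> contribute
  at the word \<open>\<mu>\<close>. The last assumption leaves \<open>\<mu>\<close> alone, with
  leading coefficient 1.\<close>

lemma lookup_immaculate_combination:
  assumes "finite A" "\<mu> \<in> A" "\<And>\<alpha>. \<alpha> \<in> A \<Longrightarrow> c \<alpha> \<noteq> 0 \<Longrightarrow> lex_le \<alpha> \<mu> \<Longrightarrow> \<alpha> = \<mu>"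
  shows "lookup (\<Sum>\<alpha>\<in>A. nsym_scale (c \<alpha>) (immaculate_comp \<alpha>)) \<mu> = c \<mu>"
proof -
  have "lookup (\<Sum>\<alpha>\<in>A. nsym_scale (c \<alpha>) (immaculate_comp \<alpha>)) \<mu> = (\<Sum>\<alpha>\<in>A. if \<alpha> = \<mu> then c \<mu> else 0)"
    unfolding lookup_sum lookup_nsym_scale
    using assms(3) imm_comp_support[of _ \<mu>] imm_comp_leading by (intro sum.cong) auto
  then show ?thesis using assms(1,2) by simp
qed

lemma inj_immaculate_comp: "inj immaculate_comp"
proof (rule injI)
  fix \<alpha> \<beta> assume "immaculate_comp \<alpha> = immaculate_comp \<beta>"
  then have "lookup (immaculate_comp \<alpha>) \<beta> \<noteq> 0" "lookup (immaculate_comp \<beta>) \<alpha> \<noteq> 0"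
    using imm_comp_leading by (metis zero_neq_one)+
  then show "\<alpha> = \<beta>" using imm_comp_support lex_le_antisym by blast
qed

lemma independent_immaculate: "\<not> nsym.dependent (range immaculate_comp)"
proof
  assume "nsym.dependent (range immaculate_comp)"
  then obtain t u where t: "finite t" "t \<subseteq> range immaculate_comp" "(\<Sum>v\<in>t. nsym_scale (u v) v) = 0"
    and u: "\<exists>v\<in>t. u v \<noteq> 0" unfolding nsym.dependent_explicit by blast
  define A where "A = immaculate_comp -` t"
  have A: "finite A" unfolding A_def by (rule finite_vimageI[OF t(1) inj_immaculate_comp])
  have t_eq: "t = immaculate_comp ` A" using t(2) by (auto simp: A_def)
  have inj: "inj_on immaculate_comp A" using inj_immaculate_comp by (rule inj_on_subset) simp
  have sum0: "(\<Sum>\<alpha>\<in>A. nsym_scale (u (immaculate_comp \<alpha>)) (immaculate_comp \<alpha>)) = 0"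
    using t(3) unfolding t_eq sum.reindex[OF inj] by simp
  have "finite {\<alpha> \<in> A. u (immaculate_comp \<alpha>) \<noteq> 0}" "{\<alpha> \<in> A. u (immaculate_comp \<alpha>) \<noteq> 0} \<noteq> {}"
    using A u t_eq by auto
  \<comment> \<open>At a minimal index with nonzero coefficient nothing cancels the leading word, so
    the linear relation forces this coefficient to vanish.\<close>
  then obtain \<mu> where \<mu>: "\<mu> \<in> {\<alpha> \<in> A. u (immaculate_comp \<alpha>) \<noteq> 0}"
    "\<And>\<alpha>. \<alpha> \<in> {\<alpha> \<in> A. u (immaculate_comp \<alpha>) \<noteq> 0} \<Longrightarrow> lex_le \<alpha> \<mu> \<Longrightarrow> \<alpha> = \<mu>"
    by (rule ex_lex_minimal) blast
  have "u (immaculate_comp \<mu>) = 0"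
    using lookup_immaculate_combination[OF A, of \<mu> "\<lambda>\<alpha>. u (immaculate_comp \<alpha>)"] \<mu> sum0 by auto
  then show False using \<mu>(1) by simp
qed

text \<open>\<open>H_comp_words\<close> writes every word in the generators as a sum of immaculate
  functions, and these words span.\<close>

lemma span_immaculate: "nsym.span (range immaculate_comp) = UNIV"
proof -
  have H: "H_comp \<alpha> \<in> nsym.span (range immaculate_comp)" for \<alpha>
    unfolding H_comp_words
  proof (rule nsym.span_sum)
    fix w assume "w \<in> words \<alpha>"
    then have "content w = parts (Comp (content w))"
      using zero_notin_content by (simp add: words_def parts_Comp)
    then have "imm (content w) \<in> range immaculate_comp" by (metis rangeI)
    then show "imm (content w) \<in> nsym.span (range immaculate_comp)" by (rule nsym.span_base)
  qed
  have "h \<in> nsym.span (range immaculate_comp)" for h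
  proof (induction h rule: nsym_induct)
    case (single \<alpha> r)
    have "single \<alpha> r = nsym_scale r (H_comp \<alpha>)" by (simp add: H_comp_eq nsym_scale_single)
    then show ?case using nsym.span_scale[OF H] by metis
  qed (rule nsym.span_add)
  then show ?thesis by blast
qed

section \<open>Lexicographic bound on the coefficients\<close>

lemma D_Cons:
  assumes "a > 0"
  shows "D (part a + \<alpha>) = (if \<alpha> = 0 then {} else insert a ((+) a ` D \<alpha>))"
proof (induction \<alpha> rule: composition_rev_induct)
  case zero
  then show ?case using D_snoc[OF assms, of 0] by simp
next
  case (snoc \<alpha> s)
  have 1: "\<alpha> + part s \<noteq> 0" "part a + \<alpha> \<noteq> 0"
    using snoc(2) assms by (auto simp flip: parts_eq_Nil)
  have "D (part a + (\<alpha> + part s)) = insert (a + weight \<alpha>) (D (part a + \<alpha>))"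
    using D_snoc[OF snoc(2), of "part a + \<alpha>"] 1 by (simp add: add.assoc)
  then show ?case using snoc 1 by (auto simp: D_snoc)
qed

text \<open>The first part of a nonempty coarser \<open>\<gamma>\<close> is a nonempty partial sum
  of \<open>\<beta>\<close>, possibly the total, hence at least the first part of
  \<open>\<beta>\<close>. On equality both first parts are dropped and the relation
  \<open>finer\<close> persists.\<close>

lemma finer_imp_lex_le: "finer \<beta> \<gamma> \<Longrightarrow> lex_le \<beta> \<gamma>"
proof (induction \<beta> arbitrary: \<gamma> rule: composition_induct)
  case zero
  then show ?case by (simp add: lex_le_def)
next
  case (Cons \<beta> b)
  have wt: "weight \<gamma> = b + weight \<beta>" and sub: "D \<gamma> \<subseteq> D (part b + \<beta>)"
    using Cons(3) by (auto simp: finer_def)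
  have "\<gamma> \<noteq> 0" using wt Cons(2) by auto
  then obtain \<delta> c where \<gamma>: "\<gamma> = part c + \<delta>" "c > 0" by (cases \<gamma> rule: composition_cases_Cons) auto
  have "b < c \<or> b = c \<and> finer \<beta> \<delta>"
  proof (cases "\<delta> = 0")
    case True
    then have "c = b + weight \<beta>" using wt \<gamma> by simp
    then show ?thesis using True by (cases "\<beta> = 0") (auto simp: finer_def neq0_conv[symmetric] simp del: neq0_conv)
  next
    case False
    then have "c \<in> D (part b + \<beta>)" using sub \<gamma> by (simp add: D_Cons)
    then have \<beta>: "\<beta> \<noteq> 0" "c = b \<or> c \<in> (+) b ` D \<beta>" using Cons(2) by (auto simp: D_Cons split: if_splits)
    show ?thesis
    proof (cases "c = b")
      case True
      have "D \<delta> \<subseteq> D \<beta>"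
      proof
        fix x assume x: "x \<in> D \<delta>"
        then have "b + x \<in> insert b ((+) b ` D \<beta>)"
          using sub \<gamma> False True \<beta>(1) Cons(2) by (auto simp: D_Cons)
        moreover have "x \<noteq> 0" using x D_subset[of \<delta>] by auto
        ultimately show "x \<in> D \<beta>" by auto
      qed
      then show ?thesis using True wt \<gamma> by (simp add: finer_def)
    next
      case False
      then show ?thesis using \<beta>(2) by auto
    qed
  qed
  then show ?case using Cons(1)[of \<delta>] \<gamma> Cons(2) by (auto simp: lex_le_def)
qed

lemma lookup_ribbon_neq_0: "lookup (ribbon \<beta>) \<gamma> \<noteq> 0 \<Longrightarrow> lex_le \<beta> \<gamma>"
proof (rule ccontr)
  assume *: "lookup (ribbon \<beta>) \<gamma> \<noteq> 0" "\<not> lex_le \<beta> \<gamma>"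
  then have "\<not> finer \<beta> \<gamma>" using finer_imp_lex_le by blast
  then have "lookup (ribbon \<beta>) \<gamma> = 0"
    unfolding ribbon_def lookup_sum lookup_sign_mult H_comp_eq
    by (intro sum.neutral) (auto simp: lookup_single when_def)
  with *(1) show False ..
qed

text \<open>Take a lexicographically minimal counterexample \<open>\<mu>\<close>. By triangularity
  the ribbon has coefficient \<open>L \<mu> \<beta>\<close> at the word \<open>\<mu>\<close>, yet
  all words of the ribbon are lexicographically at least \<open>\<beta>\<close>.\<close>

lemma L_neq_0:
  assumes "weight \<alpha> = weight \<beta>" "L \<alpha> \<beta> \<noteq> 0"
  shows "lex_le \<beta> \<alpha>"
proof (rule ccontr)
  define A where "A = {\<alpha>. weight \<alpha> = weight \<beta> \<and> L \<alpha> \<beta> \<noteq> 0 \<and> \<not> lex_le \<beta> \<alpha>}"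
  assume "\<not> lex_le \<beta> \<alpha>"
  then have "A \<noteq> {}" using assms by (auto simp: A_def)
  moreover have "finite A" by (rule finite_subset[OF _ finite_weight_eq[of "weight \<beta>"]]) (auto simp: A_def)
  ultimately obtain \<mu> where \<mu>: "\<mu> \<in> A" "\<And>\<alpha>. \<alpha> \<in> A \<Longrightarrow> lex_le \<alpha> \<mu> \<Longrightarrow> \<alpha> = \<mu>"
    using ex_lex_minimal by metis
  have "lookup (ribbon \<beta>) \<mu> = of_nat (L \<mu> \<beta>)"
    unfolding ribbon_expansion
  proof (rule lookup_immaculate_combination)
    fix \<alpha> assume \<alpha>: "\<alpha> \<in> {\<alpha>. weight \<alpha> = weight \<beta>}" "of_nat (L \<alpha> \<beta>) \<noteq> (0 :: rat)" "lex_le \<alpha> \<mu>"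
    \<comment> \<open>By transitivity an index at most \<open>\<mu>\<close> is not above
      \<open>\<beta>\<close> either, so it is a counterexample too and minimality applies.\<close>
    then have "\<not> lex_le \<beta> \<alpha>" using \<mu>(1) lex_le_trans by (auto simp: A_def)
    then show "\<alpha> = \<mu>" using \<alpha> by (intro \<mu>(2)) (auto simp: A_def)
  qed (use \<mu>(1) in \<open>auto simp: A_def\<close>)
  then have "lex_le \<beta> \<mu>" using \<mu>(1) by (intro lookup_ribbon_neq_0) (simp add: A_def)
  then show False using \<mu>(1) by (simp add: A_def)
qed

theorem theorem3p15:
  fixes \<beta> :: composition
  shows "ribbon \<beta> =
      (\<Sum>\<alpha> | weight \<alpha> = weight \<beta> \<and> lex_le \<beta> \<alpha>. nsym_scale (of_nat (L \<alpha> \<beta>)) (immaculate_comp \<alpha>))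
    \<and> (inj immaculate_comp
      \<and> \<not> nsym.dependent (range immaculate_comp)
      \<and> nsym.span (range immaculate_comp) = UNIV
      \<and> (\<forall>\<alpha>. nsym.representation (range immaculate_comp) (ribbon \<beta>) (immaculate_comp \<alpha>) \<ge> 0))"
proof (intro conjI allI)
  show "ribbon \<beta> =
      (\<Sum>\<alpha> | weight \<alpha> = weight \<beta> \<and> lex_le \<beta> \<alpha>. nsym_scale (of_nat (L \<alpha> \<beta>)) (immaculate_comp \<alpha>))"
    unfolding ribbon_expansion
    by (rule sum.mono_neutral_right) (use L_neq_0 in \<open>force+\<close>)
  show "nsym.representation (range immaculate_comp) (ribbon \<beta>) (immaculate_comp \<alpha>) \<ge> 0" for \<alpha>
    \<comment> \<open>Each immaculate function has coordinate 1 at itself and 0 at the other basis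
      vectors, so the coordinates of the ribbon are sums of natural numbers
      \<open>L\<close>.\<close>
    unfolding ribbon_expansion
    by (simp add: nsym.representation_sum nsym.representation_scale nsym.representation_basis
      independent_immaculate span_immaculate sum_nonneg)
qed (rule inj_immaculate_comp independent_immaculate span_immaculate)+

end
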